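(* There exists an absolute constant $c>0$ such that the following holds for all integers $d\ge2$, all $0<\epsilon<1$, and all $\mu\le\min(d^{1-\epsilon},\,d/100)$. Let $\mathcal C$ be the cover time for the frog model on $\mathbb T_d^n$ with initial sleeping frog counts given by an independent collection of random variables $(\eta(v))$, $v$ ranging over the non-root vertices of $\mathbb T_d^n$, with $\mathbf E\,\eta(v)\le\mu$ for all $v$. Then $$\mathbf P\bigl[\mathcal C<e^{c\sqrt{\epsilon n\log d}}\bigr]\le e^{-c\sqrt{\epsilon n\log d}}\qquad\text{for all } n\ge\frac{\log d}{c^2\epsilon}.$$
   Context: $\mathbb T_d^n$ is the rooted tree with levels $0,\dots,n$ in which every vertex in levels $0,\dots,n-1$ has exactly $d$ children. The frog model on $\mathbb T_d^n$: at time $0$ there is one awake frog at the root, and each non-root vertex $v$ has $\eta(v)$ sleeping frogs ($\eta(v)$ a nonnegative-integer-valued random variable). In discrete time, each awake frog performs a simple random walk on the tree. When a vertex is visited for the first time, all frogs sleeping there wake and begin their own simple random walks. All walks and all counts $\eta(v)$ are mutually independent. The cover time is the first time by which every vertex has been visited by an awake frog. $\log$ is the natural logarithm. *)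

theory Defs
  imports "HOL-Probability.Probability"
begin

text \<open>A vertex is coded by the path from it up to the root: \<open>[]\<close> is the root, the level of a
  vertex is its length, and the children of \<open>v\<close> are \<open>i # v\<close> for \<open>i < d\<close>.\<close>

type_synonym vertex = "nat list"

text \<open>A frog is named by its home vertex and an index; at most finitely many of the names
  \<open>(v, i)\<close> at \<open>v\<close> belong to frogs that exist (see \<open>frogs_at\<close>).\<close>

type_synonym frog = "vertex \<times> nat"

definition tree_verts :: "nat \<Rightarrow> nat \<Rightarrow> vertex set" where
  "tree_verts d n = {v. length v \<le> n \<and> set v \<subseteq> {..<d}}"

definition nonroot_verts :: "nat \<Rightarrow> nat \<Rightarrow> vertex set" where
  "nonroot_verts d n = tree_verts d n - {[]}"

definition nbrs :: "nat \<Rightarrow> nat \<Rightarrow> vertex \<Rightarrow> vertex set" where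
  "nbrs d n v = {w \<in> tree_verts d n. (\<exists>i. w = i # v) \<or> (\<exists>i. v = i # w)}"


text \<open>The law of simple random walk is built from independent instructions: \<open>\<xi> (t, x)\<close> is a
  uniformly chosen neighbour of \<open>x\<close>, to be used if the walk is at \<open>x\<close> at time \<open>t\<close>.
  Each instruction is used at most once; lemma \<open>measure_srw_cylinder\<close> below
  gives the finite-dimensional distributions.\<close>

primrec walk_path :: "vertex \<Rightarrow> (nat \<times> vertex \<Rightarrow> vertex) \<Rightarrow> nat \<Rightarrow> vertex" where
  "walk_path v \<xi> 0 = v"
| "walk_path v \<xi> (Suc t) = \<xi> (t, walk_path v \<xi> t)"

abbreviation path_space :: "(nat \<Rightarrow> vertex) measure" where
  "path_space \<equiv> \<Pi>\<^sub>M t\<in>UNIV. count_space UNIV"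

abbreviation instructions :: "nat \<Rightarrow> nat \<Rightarrow> (nat \<times> vertex \<Rightarrow> vertex) measure" where
  "instructions d n \<equiv> \<Pi>\<^sub>M (t, x)\<in>UNIV. measure_pmf (pmf_of_set (nbrs d n x))"

definition srw :: "nat \<Rightarrow> nat \<Rightarrow> vertex \<Rightarrow> (nat \<Rightarrow> vertex) measure" where
  "srw d n v = distr (instructions d n) path_space (walk_path v)"


text \<open>In the remaining definitions \<open>\<eta>\<close> gives the sleeping frog counts, and \<open>X f\<close> is the trajectory of
  frog \<open>f\<close>, with time counted from the moment at which \<open>f\<close> wakes.\<close>

definition frogs_at :: "(vertex \<Rightarrow> nat) \<Rightarrow> vertex \<Rightarrow> nat" where
  "frogs_at \<eta> v = (if v = [] then 1 else \<eta> v)"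

text \<open>\<open>first_visit \<eta> X t v\<close> is \<open>Some s\<close> if the first visit to \<open>v\<close> happens at time \<open>s \<le> t\<close>,
  and \<open>None\<close> if \<open>v\<close> is unvisited up to and including time \<open>t\<close>. Frogs at \<open>u\<close> wake at the first
  visit time \<open>s\<close> of \<open>u\<close>, and make their first step at time \<open>s + 1\<close>.\<close>

primrec first_visit ::
  "(vertex \<Rightarrow> nat) \<Rightarrow> (frog \<Rightarrow> nat \<Rightarrow> vertex) \<Rightarrow> nat \<Rightarrow> vertex \<Rightarrow> nat option" where
  "first_visit \<eta> X 0 = [[] \<mapsto> 0]"
| "first_visit \<eta> X (Suc t) = (\<lambda>v.
     case first_visit \<eta> X t v of
       Some s \<Rightarrow> Some s
     | None \<Rightarrow>
         (if \<exists>u s i. first_visit \<eta> X t u = Some s \<and> i < frogs_at \<eta> u \<and> X (u, i) (Suc t - s) = v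
          then Some (Suc t) else None))"

definition cover_time ::
  "nat \<Rightarrow> nat \<Rightarrow> (vertex \<Rightarrow> nat) \<times> (frog \<Rightarrow> nat \<Rightarrow> vertex) \<Rightarrow> enat" where
  "cover_time d n = (\<lambda>(\<eta>, X). INF t \<in> {t. \<forall>v\<in>tree_verts d n. first_visit \<eta> X t v \<noteq> None}. enat t)"

text \<open>The joint law of counts and walks, all independent, where \<open>p v\<close> is the law of \<open>\<eta> v\<close>.
  By lemma \<open>distr_eq_frog_model\<close> below, every realization of the model has this law.\<close>

definition frog_model ::
  "nat \<Rightarrow> nat \<Rightarrow> (vertex \<Rightarrow> nat pmf) \<Rightarrow> ((vertex \<Rightarrow> nat) \<times> (frog \<Rightarrow> nat \<Rightarrow> vertex)) measure" where
  "frog_model d n p =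
     (\<Pi>\<^sub>M v\<in>nonroot_verts d n. measure_pmf (p v)) \<Otimes>\<^sub>M
     (\<Pi>\<^sub>M (v, i)\<in>tree_verts d n \<times> UNIV. srw d n v)"


section \<open>Basic properties\<close>

lemma finite_tree_verts: "finite (tree_verts d n)"
proof -
  have "tree_verts d n = {v. set v \<subseteq> {..<d} \<and> length v \<le> n}"
    by (auto simp: tree_verts_def)
  then show ?thesis
    using finite_lists_length_le[of "{..<d}" n] by simp
qed

lemma finite_nbrs: "finite (nbrs d n v)"
  by (rule finite_subset[OF _ finite_tree_verts[of d n]]) (auto simp: nbrs_def)

lemma nbrs_nonempty:
  assumes "v \<in> tree_verts d n" "d \<ge> 1" "n \<ge> 1"
  shows "nbrs d n v \<noteq> {}"
proof (cases v)
  case Nil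
  then have "[0] \<in> nbrs d n v" using assms by (auto simp: nbrs_def tree_verts_def)
  then show ?thesis by blast
next
  case (Cons a w)
  then have "w \<in> nbrs d n v" using assms by (auto simp: nbrs_def tree_verts_def)
  then show ?thesis by blast
qed

lemma prob_space_instructions: "prob_space (instructions d n)"
  by (rule prob_space_PiM) (auto simp: case_prod_beta prob_space_measure_pmf)

lemma sets_instructions:
  "sets (instructions d n) = sets (\<Pi>\<^sub>M i\<in>UNIV. count_space UNIV)"
  by (rule sets_PiM_cong) auto

lemma measurable_walk_path: "walk_path v \<in> measurable (instructions d n) path_space"
proof -
  have *: "(\<lambda>\<xi>. walk_path v \<xi> t) \<in> measurable (\<Pi>\<^sub>M i\<in>UNIV. count_space UNIV) (count_space UNIV)" for t
  proof (induction t)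
    case (Suc t)
    have "(\<lambda>\<xi>. (\<lambda>x \<xi>. \<xi> (t, x)) (walk_path v \<xi> t) \<xi>) \<in>
        measurable (\<Pi>\<^sub>M i\<in>(UNIV :: (nat \<times> vertex) set). count_space (UNIV :: vertex set)) (count_space UNIV)"
      by (rule measurable_compose_countable[OF _ Suc]) measurable
    then show ?case by simp
  qed simp
  have "walk_path v \<in> measurable (\<Pi>\<^sub>M i\<in>UNIV. count_space UNIV) path_space"
    by (rule measurable_PiM_single') (auto intro: *)
  then show ?thesis
    using measurable_cong_sets[OF sets_instructions refl] by blast
qed

lemma prob_space_srw: "prob_space (srw d n v)"
  unfolding srw_def by (rule prob_space.prob_space_distr[OF prob_space_instructions measurable_walk_path])

lemma sets_srw [measurable_cong]: "sets (srw d n v) = sets path_space"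
  by (simp add: srw_def)

lemma space_srw: "space (srw d n v) = UNIV"
  by (simp add: srw_def space_PiM)

lemma measure_srw_cylinder:
  assumes "v \<in> tree_verts d n" "d \<ge> 1" "n \<ge> 1"
  shows "measure (srw d n v) {X. \<forall>s\<le>t. X s = x s} =
    (if x 0 = v \<and> (\<forall>s<t. x (Suc s) \<in> nbrs d n (x s))
     then \<Prod>s<t. 1 / real (card (nbrs d n (x s))) else 0)"
proof -
  let ?I = "instructions d n"
  interpret product_prob_space "\<lambda>(t :: nat, x). measure_pmf (pmf_of_set (nbrs d n x))" UNIV
    by (rule product_prob_spaceI) (auto simp: case_prod_beta prob_space_measure_pmf)
  have sp: "space ?I = UNIV" by (auto simp: space_PiM case_prod_beta)
  have meas: "{X. \<forall>s\<le>t. X s = x s} \<in> sets path_space"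
  proof -
    have "{X \<in> space path_space. \<forall>s\<in>{..t}. X s = x s} \<in> sets path_space"
      by measurable
    then show ?thesis by (simp add: space_PiM Ball_def)
  qed
  have path_iff: "(\<forall>s\<le>t. walk_path v \<xi> s = x s) \<longleftrightarrow> x 0 = v \<and> (\<forall>s<t. \<xi> (s, x s) = x (Suc s))"
    for \<xi>
    by (induction t) (auto simp: le_Suc_eq less_Suc_eq)
  have 1: "measure (srw d n v) {X. \<forall>s\<le>t. X s = x s} =
      measure ?I {\<xi>. x 0 = v \<and> (\<forall>s<t. \<xi> (s, x s) = x (Suc s))}"
    unfolding srw_def
    by (subst measure_distr[OF measurable_walk_path meas]) (simp add: sp vimage_def path_iff)
  show ?thesis
  proof (cases "x 0 = v")
    case False
    then show ?thesis unfolding 1 by simp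
  next
    case True
    let ?J = "(\<lambda>s. (s, x s)) ` {..<t}"
    let ?A = "\<lambda>(s, y :: vertex). {x (Suc s)}"
    have inj: "inj_on (\<lambda>s. (s, x s)) {..<t}" by (auto simp: inj_on_def)
    have "{\<xi>. x 0 = v \<and> (\<forall>s<t. \<xi> (s, x s) = x (Suc s))} = {\<xi> \<in> space ?I. \<forall>i\<in>?J. \<xi> i \<in> ?A i}"
      using True by (auto simp: sp)
    then have "emeasure ?I {\<xi>. x 0 = v \<and> (\<forall>s<t. \<xi> (s, x s) = x (Suc s))} =
        (\<Prod>i\<in>?J. emeasure (case i of (t, x) \<Rightarrow> measure_pmf (pmf_of_set (nbrs d n x))) (?A i))"
      by (simp only:) (rule emeasure_PiM_Collect; auto simp: case_prod_beta)
    also have "\<dots> = (\<Prod>s<t. emeasure (measure_pmf (pmf_of_set (nbrs d n (x s)))) {x (Suc s)})"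
      by (subst prod.reindex[OF inj]) simp
    also have "\<dots> = ennreal (\<Prod>s<t. pmf (pmf_of_set (nbrs d n (x s))) (x (Suc s)))"
      by (simp add: emeasure_pmf_single prod_ennreal)
    finally have 2: "measure ?I {\<xi>. x 0 = v \<and> (\<forall>s<t. \<xi> (s, x s) = x (Suc s))} =
        (\<Prod>s<t. pmf (pmf_of_set (nbrs d n (x s))) (x (Suc s)))"
      by (simp add: measure_def prod_nonneg)
    show ?thesis
    proof (cases "\<forall>s<t. x (Suc s) \<in> nbrs d n (x s)")
      case T: True
      have "x s \<in> tree_verts d n" if "s < t" for s
        using that assms(1) True T by (cases s) (auto simp: nbrs_def)
      then have "pmf (pmf_of_set (nbrs d n (x s))) (x (Suc s)) = 1 / real (card (nbrs d n (x s)))"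
        if "s < t" for s
        using T that nbrs_nonempty[of "x s" d n] assms
        by (subst pmf_of_set) (auto simp: finite_nbrs)
      then show ?thesis unfolding 1 2 using T True by auto
    next
      case False
      define s where "s = (LEAST s. s < t \<and> x (Suc s) \<notin> nbrs d n (x s))"
      have s: "s < t" "x (Suc s) \<notin> nbrs d n (x s)"
        using LeastI_ex[of "\<lambda>s. s < t \<and> x (Suc s) \<notin> nbrs d n (x s)"] False
        unfolding s_def by blast+
      have before: "x (Suc r) \<in> nbrs d n (x r)" if "r < s" for r
        using not_less_Least[of r "\<lambda>s. s < t \<and> x (Suc s) \<notin> nbrs d n (x s)"] that s(1)
        unfolding s_def by fastforce
      have "x s \<in> tree_verts d n"
        using before assms(1) True by (cases s) (auto simp: nbrs_def)
      then have "pmf (pmf_of_set (nbrs d n (x s))) (x (Suc s)) = 0"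
        using s nbrs_nonempty[of "x s" d n] assms
        by (subst pmf_of_set) (auto simp: finite_nbrs)
      then show ?thesis unfolding 1 2 using s False by (auto intro!: prod_zero)
    qed
  qed
qed

lemma prob_space_frog_model: "prob_space (frog_model d n p)"
proof -
  interpret A: prob_space "\<Pi>\<^sub>M v\<in>nonroot_verts d n. measure_pmf (p v)"
    by (rule prob_space_PiM) (rule prob_space_measure_pmf)
  interpret B: prob_space "\<Pi>\<^sub>M (v, i)\<in>tree_verts d n \<times> (UNIV :: nat set). srw d n v"
    by (rule prob_space_PiM) (auto simp: prob_space_srw)
  interpret pair_prob_space "\<Pi>\<^sub>M v\<in>nonroot_verts d n. measure_pmf (p v)"
      "\<Pi>\<^sub>M (v, i)\<in>tree_verts d n \<times> (UNIV :: nat set). srw d n v" ..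
  show ?thesis unfolding frog_model_def by unfold_locales
qed

lemma sets_frog_model [measurable_cong]:
  "sets (frog_model d n p) = sets ((\<Pi>\<^sub>M v\<in>nonroot_verts d n. count_space UNIV) \<Otimes>\<^sub>M
     (\<Pi>\<^sub>M f\<in>tree_verts d n \<times> UNIV. path_space))"
  unfolding frog_model_def
  by (intro sets_pair_measure_cong sets_PiM_cong) (auto simp: sets_srw)

text \<open>Outside the index sets the coordinates are constant, so measurability holds for all of them.\<close>

lemma measurable_coords:
  shows "(\<lambda>\<omega>. fst \<omega> v) \<in> measurable (frog_model d n p) (count_space UNIV)"
    and "(\<lambda>\<omega>. snd \<omega> f t) \<in> measurable (frog_model d n p) (count_space UNIV)"
proof -
  let ?A = "\<Pi>\<^sub>M v\<in>nonroot_verts d n. count_space (UNIV :: nat set)"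
  let ?B = "\<Pi>\<^sub>M f\<in>tree_verts d n \<times> (UNIV :: nat set). path_space"
  have a: "(\<lambda>x. x v) \<in> measurable ?A (count_space UNIV)"
  proof (cases "v \<in> nonroot_verts d n")
    case False
    then have "(\<lambda>x. x v) \<in> measurable ?A (count_space UNIV)
        \<longleftrightarrow> (\<lambda>x. undefined) \<in> measurable ?A (count_space (UNIV :: nat set))"
      by (intro measurable_cong) (auto simp: space_PiM PiE_def extensional_def)
    then show ?thesis by simp
  qed measurable
  have b: "(\<lambda>x. x f t) \<in> measurable ?B (count_space UNIV)"
  proof (cases "f \<in> tree_verts d n \<times> (UNIV :: nat set)")
    case True
    have "(\<lambda>x. x f) \<in> measurable ?B path_space"
      using True by (rule measurable_component_singleton)
    moreover have "(\<lambda>x. x t) \<in> measurable path_space (count_space UNIV)"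
      by (rule measurable_component_singleton) simp
    ultimately show ?thesis by (rule measurable_compose)
  next
    case False
    then have "(\<lambda>x. x f t) \<in> measurable ?B (count_space UNIV)
        \<longleftrightarrow> (\<lambda>x. (undefined :: nat \<Rightarrow> vertex) t) \<in> measurable ?B (count_space UNIV)"
      by (intro measurable_cong) (cases f; auto simp: space_PiM PiE_def extensional_def)
    then show ?thesis by simp
  qed
  have c: "measurable (frog_model d n p) (count_space S) = measurable (?A \<Otimes>\<^sub>M ?B) (count_space S)" for S :: "'x set"
    by (rule measurable_cong_sets[OF sets_frog_model refl])
  show "(\<lambda>\<omega>. fst \<omega> v) \<in> measurable (frog_model d n p) (count_space UNIV)"
    unfolding c by (rule measurable_compose[OF measurable_fst a])
  show "(\<lambda>\<omega>. snd \<omega> f t) \<in> measurable (frog_model d n p) (count_space UNIV)"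
    unfolding c by (rule measurable_compose[OF measurable_snd b])
qed

lemma measurable_first_visit:
  "(\<lambda>\<omega>. first_visit (fst \<omega>) (snd \<omega>) t v) \<in> measurable (frog_model d n p) (count_space UNIV)"
proof (induction t arbitrary: v)
  case 0
  show ?case by simp
next
  case (Suc t)
  let ?M = "frog_model d n p"
  note Suc[measurable] measurable_coords[measurable]
  have [measurable]: "(\<lambda>\<omega>. frogs_at (fst \<omega>) u) \<in> measurable ?M (count_space UNIV)" for u
    unfolding frogs_at_def by (cases "u = []") auto
  have [measurable]: "Measurable.pred ?M (\<lambda>\<omega>. \<exists>u s i. first_visit (fst \<omega>) (snd \<omega>) t u = Some s \<and>
      i < frogs_at (fst \<omega>) u \<and> snd \<omega> (u, i) (Suc t - s) = v)"
    by measurable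
  have "(\<lambda>\<omega>. (\<lambda>o' \<omega>. case o' of Some s \<Rightarrow> Some s | None \<Rightarrow>
      (if \<exists>u s i. first_visit (fst \<omega>) (snd \<omega>) t u = Some s \<and>
          i < frogs_at (fst \<omega>) u \<and> snd \<omega> (u, i) (Suc t - s) = v then Some (Suc t) else None))
      (first_visit (fst \<omega>) (snd \<omega>) t v) \<omega>) \<in> measurable ?M (count_space UNIV)"
  proof (rule measurable_compose_countable[OF _ Suc])
    fix o' :: "nat option"
    show "(\<lambda>\<omega>. case o' of Some s \<Rightarrow> Some s | None \<Rightarrow>
      (if \<exists>u s i. first_visit (fst \<omega>) (snd \<omega>) t u = Some s \<and>
          i < frogs_at (fst \<omega>) u \<and> snd \<omega> (u, i) (Suc t - s) = v then Some (Suc t) else None))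
      \<in> measurable ?M (count_space UNIV)"
      by (cases o') (simp_all, measurable)
  qed
  then show ?case by simp
qed

lemma measurable_cover_time [measurable]:
  "cover_time d n \<in> measurable (frog_model d n p) (count_space UNIV)"
proof -
  let ?M = "frog_model d n p"
  let ?P = "\<lambda>t \<omega>. \<forall>v\<in>tree_verts d n. first_visit (fst \<omega>) (snd \<omega>) t v \<noteq> None"
  note measurable_first_visit[measurable]
  have [measurable]: "Measurable.pred ?M (?P t)" for t
    using finite_tree_verts[of d n] by measurable
  have eq: "cover_time d n = (\<lambda>\<omega>. INF t. if ?P t \<omega> then enat t else \<infinity>)"
  proof (rule ext, rule antisym)
    fix \<omega> :: "(vertex \<Rightarrow> nat) \<times> (frog \<Rightarrow> nat \<Rightarrow> vertex)"
    show "cover_time d n \<omega> \<le> (INF t. if ?P t \<omega> then enat t else \<infinity>)"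
      by (rule INF_greatest) (auto simp: cover_time_def case_prod_beta intro: INF_lower)
    show "(INF t. if ?P t \<omega> then enat t else \<infinity>) \<le> cover_time d n \<omega>"
      unfolding cover_time_def case_prod_beta
    proof (rule INF_greatest)
      fix t assume "t \<in> {t. ?P t \<omega>}"
      then show "(INF t. if ?P t \<omega> then enat t else \<infinity>) \<le> enat t"
        by (intro INF_lower2[of t]) auto
    qed
  qed
  show ?thesis unfolding eq by measurable
qed

lemma (in prob_space) distr_eq_frog_model:
  fixes d n :: nat and \<eta> :: "vertex \<Rightarrow> 'a \<Rightarrow> nat" and X :: "frog \<Rightarrow> 'a \<Rightarrow> nat \<Rightarrow> vertex"
  defines "A \<equiv> \<Pi>\<^sub>M v\<in>nonroot_verts d n. count_space UNIV"
    and "B \<equiv> \<Pi>\<^sub>M f\<in>tree_verts d n \<times> (UNIV :: nat set). path_space"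
    and "\<eta>' \<equiv> \<lambda>\<omega>. \<lambda>v\<in>nonroot_verts d n. \<eta> v \<omega>"
    and "X' \<equiv> \<lambda>\<omega>. \<lambda>f\<in>tree_verts d n \<times> UNIV. X f \<omega>"
  assumes ne: "nonroot_verts d n \<noteq> {}"
    and indep_\<eta>: "indep_vars (\<lambda>_. count_space UNIV) \<eta> (nonroot_verts d n)"
    and indep_X: "indep_vars (\<lambda>_. path_space) X (tree_verts d n \<times> UNIV)"
    and indep_\<eta>_X: "indep_set {\<eta>' -` S \<inter> space M |S. S \<in> sets A} {X' -` S \<inter> space M |S. S \<in> sets B}"
    and law_\<eta>: "\<And>v. v \<in> nonroot_verts d n \<Longrightarrow> distr M (count_space UNIV) (\<eta> v) = measure_pmf (p v)"
    and law_X: "\<And>v i. v \<in> tree_verts d n \<Longrightarrow> distr M path_space (X (v, i)) = srw d n v"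
  shows "distr M (A \<Otimes>\<^sub>M B) (\<lambda>\<omega>. (\<eta>' \<omega>, X' \<omega>)) = frog_model d n p"
proof -
  have ne': "tree_verts d n \<times> (UNIV :: nat set) \<noteq> {}"
    using ne by (auto simp: nonroot_verts_def)
  have rv: "random_variable (count_space UNIV) (\<eta> v)" if "v \<in> nonroot_verts d n" for v
    using indep_\<eta> that by (auto simp: indep_vars_def)
  have rv': "random_variable path_space (X f)" if "f \<in> tree_verts d n \<times> UNIV" for f
    using indep_X that unfolding indep_vars_def by blast
  have m1: "random_variable A \<eta>'"
    unfolding A_def \<eta>'_def by (rule measurable_restrict) (rule rv)
  have m2: "random_variable B X'"
    unfolding B_def X'_def by (rule measurable_restrict) (rule rv')
  have 1: "distr M A \<eta>' = (\<Pi>\<^sub>M v\<in>nonroot_verts d n. measure_pmf (p v))"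
    unfolding A_def \<eta>'_def
    using indep_\<eta> indep_vars_iff_distr_eq_PiM'[OF ne rv] law_\<eta>
    by (auto intro: PiM_cong)
  have "distr M B X' = (\<Pi>\<^sub>M f\<in>tree_verts d n \<times> UNIV. distr M path_space (X f))"
    unfolding B_def X'_def
    using indep_X indep_vars_iff_distr_eq_PiM'[OF ne' rv'] by simp
  also have "\<dots> = (\<Pi>\<^sub>M (v, i)\<in>tree_verts d n \<times> UNIV. srw d n v)"
    using law_X by (intro PiM_cong) auto
  finally have 2: "distr M B X' = (\<Pi>\<^sub>M (v, i)\<in>tree_verts d n \<times> UNIV. srw d n v)" .
  interpret P: prob_space "distr M A \<eta>'" by (rule prob_space_distr[OF m1])
  interpret Q: prob_space "distr M B X'" by (rule prob_space_distr[OF m2])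
  have "distr M A \<eta>' \<Otimes>\<^sub>M distr M B X' = distr M (A \<Otimes>\<^sub>M B) (\<lambda>\<omega>. (\<eta>' \<omega>, X' \<omega>))"
  proof (rule pair_measure_eqI)
    fix S T assume "S \<in> sets (distr M A \<eta>')" "T \<in> sets (distr M B X')"
    then have S: "S \<in> sets A" and T: "T \<in> sets B" by auto
    have "prob ((\<eta>' -` S \<inter> space M) \<inter> (X' -` T \<inter> space M))
        = prob (\<eta>' -` S \<inter> space M) * prob (X' -` T \<inter> space M)"
      using S T by (intro indep_setD[OF indep_\<eta>_X]) auto
    moreover have "(\<lambda>\<omega>. (\<eta>' \<omega>, X' \<omega>)) -` (S \<times> T) \<inter> space M
        = (\<eta>' -` S \<inter> space M) \<inter> (X' -` T \<inter> space M)"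
      by auto
    ultimately show "emeasure (distr M A \<eta>') S * emeasure (distr M B X') T
        = emeasure (distr M (A \<Otimes>\<^sub>M B) (\<lambda>\<omega>. (\<eta>' \<omega>, X' \<omega>))) (S \<times> T)"
      using S T m1 m2
      by (simp add: emeasure_distr emeasure_eq_measure ennreal_mult' measure_nonneg)
  qed (simp_all add: P.sigma_finite_measure_axioms Q.sigma_finite_measure_axioms)
  then show ?thesis unfolding 1 2 frog_model_def by simp
qed

end

theory Submission
  imports Defs
begin

text \<open>The first visit to a vertex at time \<open>s\<close> is the work of a chain of frogs, each woken by its
  predecessor. Their pieces of trajectory join to a nearest-neighbour route of length \<open>s\<close> from the
  root. The homes of the frogs in a chain are distinct, and since a vertex of a tree is reached for
  the first time from its parent, the chain changes to a new frog only after a step down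
  (\<open>first_visit_route\<close>). By independence, the expected number of chains along a given route is at most
  the product of the step probabilities with an extra factor \<open>1 + \<mu>\<close> for each step down.

  Away from the root and the leaves, the weighted steps make both \<open>\<alpha> ^ level\<close> and \<open>\<beta> ^ level\<close> decrease
  on average, where \<open>\<alpha> = 2 / (d + 1)\<close> and \<open>\<beta> = (d + 1) / (2 d (1 + \<mu>))\<close>. So an ascent through \<open>m\<close>
  levels carries total weight of order \<open>\<alpha> ^ m\<close>, a descent weight of order \<open>\<beta> ^ (-m)\<close>, and together
  they gain the factor \<open>r ^ m\<close>, where \<open>r = \<alpha> / \<beta> = 4 d (1 + \<mu>) / (d + 1)\<^sup>2\<close>. The hypotheses on \<open>\<mu>\<close>
  give \<open>r \<le> 91/100\<close> and \<open>r \<le> d powr (- \<epsilon> / 100)\<close>. The leaves spoil this picture, because frogs are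
  reflected there and the plain sum over routes grows exponentially with time.

  The remedy is a multiscale argument. The lowest \<open>H * j\<close> levels are cut into \<open>H\<close> zones of \<open>j\<close>
  levels, and subtrees of height \<open>h * j\<close> are said to have scale \<open>h\<close>. The claim is that all excursions
  of duration below \<open>2 ^ h\<close> into such a subtree have total weight at most \<open>\<alpha>\<close>, as if there were no leaves.
  Of two disjoint excursions within a time below \<open>2 ^ h\<close>, at most one lasts \<open>2 ^ (h - 1)\<close> or longer. So
  such an excursion contains at most one long excursion of scale \<open>h - 1\<close>, and the short
  ones are covered by induction. For the long one the chain is forgotten and only the frog that carries it out
  is recorded: by reversibility, the expected number of pairs of a frog and a time below \<open>2 ^ H\<close> at
  which it stands at a prescribed vertex is at most \<open>2 ^ H \<mu> (d + 1)\<close>, even if all frogs are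
  awake (\<open>sum_srw_at_le\<close>). The cost \<open>2 ^ H (1 + \<mu> (d + 1))\<close> of such a jump is outweighed by the gain
  \<open>r ^ j\<close> from crossing a zone twice.

  No excursion from the top zone is long for the time up to \<open>2 ^ H\<close>, and the expected number of
  visited vertices at a level \<open>J\<close> in it is at most of order \<open>\<beta> ^ (-J)\<close>, a fraction at most of order \<open>r ^ J\<close> of all
  (\<open>cover_time_bound\<close>). If \<open>2 ^ H\<close> is about \<open>exp x\<close>, then \<open>r ^ j\<close> is small enough for some \<open>j\<close> of order
  \<open>x / (\<epsilon> ln d)\<close>, and \<open>H * j\<close> is of order \<open>x\<^sup>2 / (\<epsilon> ln d)\<close>. Room for the zones and for a top zone of depth
  of order \<open>n\<close> therefore remains for \<open>x\<close> of order \<open>sqrt (\<epsilon> n ln d)\<close>.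

  In the formal proof the sum over chains is organized as a supermartingale argument. An event
  \<open>history\<close> prescribes what finitely many frogs do up to certain times, \<open>completable\<close> says that
  the chain can be continued to its target, and the potential \<open>pot\<close> bounds the probability of a
  completion relative to the history (\<open>all_bounded\<close>), by induction on the length of the continuation.\<close>


section \<open>Simple random walk on the finite tree\<close>

text \<open>What a chain knows about its carrier is kept as an arbitrary event of this kind rather than as a single path,
  because after a long excursion only the position at the end is retained.\<close>

definition prefix_event :: "nat \<Rightarrow> (nat \<Rightarrow> vertex) set \<Rightarrow> bool" where
  "prefix_event k A \<longleftrightarrow> (\<forall>X Y. (\<forall>s\<le>k. X s = Y s) \<longrightarrow> X \<in> A \<longrightarrow> Y \<in> A)"

definition cyl :: "vertex list \<Rightarrow> (nat \<Rightarrow> vertex) set" where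
  "cyl xs = {X. \<forall>s<length xs. X s = xs ! s}"

lemma cyl_measurable [measurable]: "cyl xs \<in> sets path_space"
proof -
  have "{X \<in> space path_space. \<forall>s\<in>{..<length xs}. X s = xs ! s} \<in> sets path_space"
    by measurable
  then show ?thesis by (simp add: cyl_def space_PiM Ball_def)
qed

lemma prefix_event_Union:
  assumes "prefix_event k A"
  shows "A = (\<Union>xs\<in>{xs. length xs = Suc k \<and> cyl xs \<subseteq> A}. cyl xs)"
proof (intro equalityI subsetI)
  fix X assume X: "X \<in> A"
  let ?xs = "map X [0..<Suc k]"
  have "cyl ?xs \<subseteq> A"
  proof
    fix Y assume Y: "Y \<in> cyl ?xs"
    have "X s = Y s" if "s \<le> k" for s
      using Y that unfolding cyl_def by (auto simp del: upt_Suc simp: nth_append less_Suc_eq_le)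
    then show "Y \<in> A" using assms X unfolding prefix_event_def by blast
  qed
  moreover have "X \<in> cyl ?xs" by (auto simp: cyl_def simp del: upt_Suc)
  ultimately show "X \<in> (\<Union>xs\<in>{xs. length xs = Suc k \<and> cyl xs \<subseteq> A}. cyl xs)"
    by (intro UN_I[of ?xs]) (auto simp del: upt_Suc)
qed auto

lemma prefix_event_measurable:
  assumes "prefix_event k A" shows "A \<in> sets path_space"
proof -
  have "(\<Union>xs\<in>{xs. length xs = Suc k \<and> cyl xs \<subseteq> A}. cyl xs) \<in> sets path_space"
    using cyl_measurable by (intro sets.countable_UN') blast+
  then show ?thesis using prefix_event_Union[OF assms] by metis
qed

lemma prefix_event_Int: "prefix_event k A \<Longrightarrow> prefix_event k B \<Longrightarrow> prefix_event k (A \<inter> B)"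
  unfolding prefix_event_def by (metis IntD1 IntD2 IntI)

lemma prefix_event_mono: "prefix_event k A \<Longrightarrow> k \<le> l \<Longrightarrow> prefix_event l A"
  unfolding prefix_event_def by (meson le_trans)

lemma prefix_event_at: "prefix_event k {X. X k = y}"
  unfolding prefix_event_def by auto

lemma disjoint_cyl: "disjoint_family_on cyl {xs. length xs = m \<and> P xs}"
  unfolding disjoint_family_on_def
proof (intro ballI impI)
  fix xs ys :: "vertex list" assume "xs \<in> {xs. length xs = m \<and> P xs}" "ys \<in> {xs. length xs = m \<and> P xs}" "xs \<noteq> ys"
  then obtain s where "s < m" "xs ! s \<noteq> ys ! s" "length xs = m" "length ys = m"
    using nth_equalityI[of xs ys] by auto
  then show "cyl xs \<inter> cyl ys = {}" by (auto simp: cyl_def)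
qed

lemma srw_cyl_step:
  assumes "v \<in> tree_verts d n" "d \<ge> 1" "n \<ge> 1" "xs \<noteq> []"
  shows "emeasure (srw d n v) (cyl (xs @ [z])) \<le>
    emeasure (srw d n v) (cyl xs) * ennreal (1 / real (card (nbrs d n (last xs))))"
proof -
  interpret prob_space "srw d n v" by (rule prob_space_srw)
  obtain k where k: "length xs = Suc k" using assms(4) by (cases xs) auto
  define x where "x s = (xs @ [z]) ! s" for s
  have c: "cyl xs = {X. \<forall>s\<le>k. X s = x s}" "cyl (xs @ [z]) = {X. \<forall>s\<le>Suc k. X s = x s}"
    using k by (auto simp: cyl_def x_def nth_append less_Suc_eq_le)
  have l: "last xs = x k" using k assms(4) by (simp add: x_def nth_append last_conv_nth)
  have "measure (srw d n v) (cyl (xs @ [z])) \<le> measure (srw d n v) (cyl xs) * (1 / real (card (nbrs d n (last xs))))"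
    unfolding c l measure_srw_cylinder[OF assms(1-3)] by (auto simp: prod_nonneg)
  then show ?thesis
    unfolding emeasure_eq_measure by (subst ennreal_mult'[symmetric]) (auto intro: ennreal_leI)
qed

text \<open>The only form in which the Markov property is needed. A prefix event is a disjoint union of
  cylinders, for which the law of the walk is explicit.\<close>

lemma srw_Markov:
  assumes v: "v \<in> tree_verts d n" "d \<ge> 1" "n \<ge> 1"
    and A: "prefix_event k A" "A \<subseteq> {X. X k = y}"
  shows "emeasure (srw d n v) (A \<inter> {X. X (Suc k) = z}) \<le>
    emeasure (srw d n v) A * ennreal (1 / real (card (nbrs d n y)))"
proof -
  let ?L = "{xs. length xs = Suc k \<and> cyl xs \<subseteq> A}"
  let ?S = "srw d n v"
  have Aeq: "A = (\<Union>xs\<in>?L. cyl xs)" by (rule prefix_event_Union[OF A(1)])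
  have last: "last xs = y" if "xs \<in> ?L" for xs
  proof -
    have "(\<lambda>s. xs ! s) \<in> cyl xs" by (simp add: cyl_def)
    then have "xs ! k = y" using that A(2) by auto
    then show ?thesis using that by (cases xs rule: rev_cases) (auto simp: nth_append)
  qed
  have sub: "A \<inter> {X. X (Suc k) = z} \<subseteq> (\<Union>xs\<in>?L. cyl (xs @ [z]))"
  proof
    fix X assume X: "X \<in> A \<inter> {X. X (Suc k) = z}"
    then obtain xs where "xs \<in> ?L" "X \<in> cyl xs" using Aeq by blast
    then show "X \<in> (\<Union>xs\<in>?L. cyl (xs @ [z]))"
      using X by (intro UN_I[of xs]) (auto simp: cyl_def nth_append less_Suc_eq)
  qed
  have dis: "disjoint_family_on (\<lambda>xs. cyl (xs @ [z])) ?L"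
    unfolding disjoint_family_on_def
  proof (intro ballI impI)
    fix xs ys assume "xs \<in> ?L" "ys \<in> ?L" "xs \<noteq> ys"
    then have "cyl xs \<inter> cyl ys = {}" by (intro disjoint_family_onD[OF disjoint_cyl]) auto
    moreover have "cyl (xs @ [z]) \<subseteq> cyl xs" for xs by (auto simp: cyl_def nth_append)
    ultimately show "cyl (xs @ [z]) \<inter> cyl (ys @ [z]) = {}" by blast
  qed
  have m: "cyl xs \<in> sets ?S" for xs using cyl_measurable by (simp add: sets_srw)
  have "emeasure ?S (A \<inter> {X. X (Suc k) = z}) \<le> emeasure ?S (\<Union>xs\<in>?L. cyl (xs @ [z]))"
    by (intro emeasure_mono[OF sub] sets.countable_UN') (auto intro: m)
  also have "\<dots> = (\<integral>\<^sup>+xs. emeasure ?S (cyl (xs @ [z])) \<partial>count_space ?L)"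
    by (rule emeasure_UN_countable[OF _ _ dis]) (auto intro: m)
  also have "\<dots> \<le> (\<integral>\<^sup>+xs. emeasure ?S (cyl xs) * ennreal (1 / real (card (nbrs d n y))) \<partial>count_space ?L)"
  proof (intro nn_integral_mono)
    fix xs assume "xs \<in> space (count_space ?L)"
    then have "xs \<in> ?L" by simp
    then show "emeasure ?S (cyl (xs @ [z])) \<le> emeasure ?S (cyl xs) * ennreal (1 / real (card (nbrs d n y)))"
      using srw_cyl_step[OF v, of xs z] last[OF \<open>xs \<in> ?L\<close>] by fastforce
  qed
  also have "\<dots> = (\<integral>\<^sup>+xs. emeasure ?S (cyl xs) \<partial>count_space ?L) * ennreal (1 / real (card (nbrs d n y)))"
    by (rule nn_integral_multc) simp
  also have "(\<integral>\<^sup>+xs. emeasure ?S (cyl xs) \<partial>count_space ?L) = emeasure ?S (\<Union>xs\<in>?L. cyl xs)"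
    by (rule emeasure_UN_countable[symmetric, OF _ _ disjoint_cyl]) (auto intro: m)
  finally show ?thesis using Aeq by simp
qed

definition walks :: "nat \<Rightarrow> nat \<Rightarrow> vertex \<Rightarrow> (nat \<Rightarrow> vertex) \<Rightarrow> bool" where
  "walks d n v X \<longleftrightarrow> X 0 = v \<and> (\<forall>t. X (Suc t) \<in> nbrs d n (X t))"

lemma walks_in_tree:
  assumes "walks d n v X" "v \<in> tree_verts d n" shows "X t \<in> tree_verts d n"
  using assms by (cases t) (auto simp: walks_def nbrs_def)

lemma AE_srw_walks:
  assumes v: "v \<in> tree_verts d n" "d \<ge> 1" "n \<ge> 1"
  shows "AE X in srw d n v. walks d n v X"
proof -
  let ?I = "instructions d n"
  have pred: "Measurable.pred path_space (walks d n v)" unfolding walks_def by measurable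
  have "AE \<xi> in ?I. \<xi> i \<in> nbrs d n (snd i)" if "snd i \<in> tree_verts d n" for i
  proof -
    have *: "AE z in (case i of (t, x) \<Rightarrow> measure_pmf (pmf_of_set (nbrs d n x))). z \<in> nbrs d n (snd i)"
      using nbrs_nonempty[OF that v(2,3)] unfolding case_prod_beta AE_measure_pmf_iff
      by (simp add: set_pmf_of_set finite_nbrs)
    show ?thesis
      using AE_PiM_component[where P="\<lambda>z. z \<in> nbrs d n (snd i)" and i=i and I=UNIV
          and M="\<lambda>(t, x). measure_pmf (pmf_of_set (nbrs d n x))", OF _ _ *]
      by (simp add: case_prod_beta prob_space_measure_pmf)
  qed
  then have "AE \<xi> in ?I. \<forall>i. snd i \<in> tree_verts d n \<longrightarrow> \<xi> i \<in> nbrs d n (snd i)"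
    unfolding AE_all_countable by auto
  then have "AE \<xi> in ?I. walks d n v (walk_path v \<xi>)"
  proof eventually_elim
    fix \<xi> :: "nat \<times> vertex \<Rightarrow> vertex"
    assume *: "\<forall>i. snd i \<in> tree_verts d n \<longrightarrow> \<xi> i \<in> nbrs d n (snd i)"
    have **: "walk_path v \<xi> t \<in> tree_verts d n" for t
      using * v(1) by (induction t) (auto simp: nbrs_def)
    then show "walks d n v (walk_path v \<xi>)" using * unfolding walks_def by simp
  qed
  then show ?thesis
    unfolding srw_def using pred
    by (subst AE_distr_iff[OF measurable_walk_path]) (auto simp: pred_def)
qed

lemma nbrs_sym: "v \<in> tree_verts d n \<Longrightarrow> w \<in> nbrs d n v \<Longrightarrow> v \<in> nbrs d n w"
  by (auto simp: nbrs_def)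

lemma card_nbrs_pos:
  assumes "v \<in> tree_verts d n" "d \<ge> 1" "n \<ge> 1" shows "card (nbrs d n v) > 0"
  using nbrs_nonempty[OF assms] finite_nbrs[of d n v] by (simp add: card_gt_0_iff)

lemma nbrs_interior:
  assumes "v \<in> tree_verts d n" "v \<noteq> []" "length v < n"
  shows "nbrs d n v = insert (tl v) ((\<lambda>i. i # v) ` {..<d})" "card (nbrs d n v) = d + 1"
proof -
  show *: "nbrs d n v = insert (tl v) ((\<lambda>i. i # v) ` {..<d})"
    using assms by (cases v) (auto simp: nbrs_def tree_verts_def)
  have "tl v \<notin> (\<lambda>i. i # v) ` {..<d}"
    by (auto dest!: arg_cong[of _ _ length])
  then show "card (nbrs d n v) = d + 1"
    unfolding * by (simp add: card_image inj_on_def)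
qed

lemma nbrs_root:
  assumes "n \<ge> 1"
  shows "nbrs d n [] = (\<lambda>i. [i]) ` {..<d}" "card (nbrs d n []) = d"
proof -
  show *: "nbrs d n [] = (\<lambda>i. [i]) ` {..<d}"
    using assms by (auto simp: nbrs_def tree_verts_def)
  then show "card (nbrs d n []) = d" by (simp add: card_image inj_on_def)
qed

lemma card_nbrs_le:
  assumes "v \<in> tree_verts d n" shows "card (nbrs d n v) \<le> d + 1"
proof -
  have "nbrs d n v \<subseteq> insert (tl v) ((\<lambda>i. i # v) ` {..<d})"
    using assms by (auto simp: nbrs_def tree_verts_def)
  then have "card (nbrs d n v) \<le> card (insert (tl v) ((\<lambda>i. i # v) ` {..<d}))"
    by (rule card_mono[rotated]) auto
  also have "\<dots> \<le> Suc (card ((\<lambda>i. i # v) ` {..<d}))" by (rule card_insert_le_m1) auto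
  also have "\<dots> \<le> d + 1" using card_image_le[of "{..<d}" "\<lambda>i. i # v"] by simp
  finally show ?thesis .
qed

text \<open>Reversibility: the degree is an invariant measure of the walk. So walkers started
  with mass equal to the degree at all vertices still have mass at most the degree of \<open>z\<close> at \<open>z\<close> after \<open>k\<close> steps.\<close>

lemma sum_srw_reversed:
  assumes z: "z \<in> tree_verts d n" and d: "d \<ge> 1" "n \<ge> 1"
  shows "(\<Sum>x\<in>tree_verts d n. of_nat (card (nbrs d n x)) * emeasure (srw d n x) {X. X k = z}) \<le> of_nat (card (nbrs d n z))"
  using z
proof (induction k arbitrary: z)
  case 0
  have e: "of_nat (card (nbrs d n x)) * emeasure (srw d n x) {X. X 0 = z} \<le>
      (if x = z then of_nat (card (nbrs d n z)) else (0::ennreal))"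
    if x: "x \<in> tree_verts d n" for x
  proof -
    interpret prob_space "srw d n x" by (rule prob_space_srw)
    have 1: "emeasure (srw d n x) {X. X 0 = z} \<le> 1" by (rule emeasure_le_1)
    have "emeasure (srw d n x) {X. X 0 = z} = 0" if "x \<noteq> z"
    proof -
      have "AE X in srw d n x. X \<notin> {X. X 0 = z}"
        using AE_srw_walks[OF x d] by eventually_elim (use that in \<open>auto simp: walks_def\<close>)
      moreover have "{X. X 0 = z} \<in> sets (srw d n x)"
        using prefix_event_measurable[OF prefix_event_at] by (simp add: sets_srw)
      ultimately have "{X. X 0 = z} \<in> null_sets (srw d n x)"
        by (subst AE_iff_null_sets) auto
      then show ?thesis by auto
    qed
    then show ?thesis using mult_left_mono[OF 1, of "of_nat (card (nbrs d n x))"] by auto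
  qed
  have "(\<Sum>x\<in>tree_verts d n. of_nat (card (nbrs d n x)) * emeasure (srw d n x) {X. X 0 = z})
      \<le> (\<Sum>x\<in>tree_verts d n. (if x = z then of_nat (card (nbrs d n z)) else (0::ennreal)))"
    by (intro sum_mono e)
  also have "\<dots> = of_nat (card (nbrs d n z))" using 0 finite_tree_verts by simp
  finally show ?case .
next
  case (Suc k)
  let ?c = "\<lambda>x. of_nat (card (nbrs d n x)) :: ennreal"
  have nt: "nbrs d n z \<subseteq> tree_verts d n" by (auto simp: nbrs_def)
  have m: "{X. X k = y} \<in> sets (srw d n x)" for x y k
    using prefix_event_measurable[OF prefix_event_at] by (simp add: sets_srw)
  have step: "emeasure (srw d n x) {X. X (Suc k) = z} \<le>
      (\<Sum>y\<in>nbrs d n z. emeasure (srw d n x) {X. X k = y} * ennreal (1 / real (card (nbrs d n y))))"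
    if x: "x \<in> tree_verts d n" for x
  proof -
    have "emeasure (srw d n x) {X. X (Suc k) = z} \<le>
        emeasure (srw d n x) (\<Union>y\<in>nbrs d n z. {X. X k = y} \<inter> {X. X (Suc k) = z})"
    proof (rule emeasure_mono_AE)
      show "AE X in srw d n x. X \<in> {X. X (Suc k) = z} \<longrightarrow> X \<in> (\<Union>y\<in>nbrs d n z. {X. X k = y} \<inter> {X. X (Suc k) = z})"
        using AE_srw_walks[OF x d]
      proof eventually_elim
        fix X assume w: "walks d n x X"
        have "X (Suc k) \<in> nbrs d n (X k)" using w by (simp add: walks_def)
        then have "X k \<in> nbrs d n (X (Suc k))" using nbrs_sym walks_in_tree[OF w x] by blast
        then show "X \<in> {X. X (Suc k) = z} \<longrightarrow> X \<in> (\<Union>y\<in>nbrs d n z. {X. X k = y} \<inter> {X. X (Suc k) = z})" by auto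
      qed
    qed (use m finite_nbrs in \<open>auto intro!: sets.finite_UN\<close>)
    also have "\<dots> \<le> (\<Sum>y\<in>nbrs d n z. emeasure (srw d n x) ({X. X k = y} \<inter> {X. X (Suc k) = z}))"
      by (rule emeasure_subadditive_finite) (use m finite_nbrs in auto)
    also have "\<dots> \<le> (\<Sum>y\<in>nbrs d n z. emeasure (srw d n x) {X. X k = y} * ennreal (1 / real (card (nbrs d n y))))"
      by (intro sum_mono srw_Markov[OF x d prefix_event_at]) auto
    finally show ?thesis .
  qed
  have "(\<Sum>x\<in>tree_verts d n. ?c x * emeasure (srw d n x) {X. X (Suc k) = z})
      \<le> (\<Sum>x\<in>tree_verts d n. ?c x * (\<Sum>y\<in>nbrs d n z. emeasure (srw d n x) {X. X k = y} * ennreal (1 / real (card (nbrs d n y)))))"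
    by (intro sum_mono mult_left_mono step) auto
  also have "\<dots> = (\<Sum>y\<in>nbrs d n z. (\<Sum>x\<in>tree_verts d n. ?c x * emeasure (srw d n x) {X. X k = y}) * ennreal (1 / real (card (nbrs d n y))))"
    unfolding sum_distrib_left sum_distrib_right
    by (subst sum.swap) (simp add: mult.assoc)
  also have "\<dots> \<le> (\<Sum>y\<in>nbrs d n z. ?c y * ennreal (1 / real (card (nbrs d n y))))"
    by (intro sum_mono mult_right_mono Suc.IH) (use nt in auto)
  also have "\<dots> = (\<Sum>y\<in>nbrs d n z. 1)"
  proof (rule sum.cong[OF refl])
    fix y assume "y \<in> nbrs d n z"
    then have "card (nbrs d n y) > 0" using nt card_nbrs_pos[OF _ d] by auto
    then show "?c y * ennreal (1 / real (card (nbrs d n y))) = 1"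
      by (simp add: ennreal_of_nat_eq_real_of_nat ennreal_mult'[symmetric])
  qed
  also have "\<dots> = ?c z" by simp
  finally show ?case .
qed

text \<open>This prices a long excursion: if one walker starts at each vertex of the tree, the expected number of them at \<open>z\<close>
  at a given time is bounded uniformly in the size of the tree.\<close>

lemma sum_srw_at_le:
  assumes z: "z \<in> tree_verts d n" and d: "d \<ge> 1" "n \<ge> 1"
  shows "(\<Sum>x\<in>tree_verts d n. emeasure (srw d n x) {X. X k = z}) \<le> ennreal (real d + 1)"
proof -
  have "(\<Sum>x\<in>tree_verts d n. emeasure (srw d n x) {X. X k = z})
     \<le> (\<Sum>x\<in>tree_verts d n. of_nat (card (nbrs d n x)) * emeasure (srw d n x) {X. X k = z})"
  proof (intro sum_mono)
    fix x assume "x \<in> tree_verts d n"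
    then have "(1::ennreal) \<le> of_nat (card (nbrs d n x))" 
      using card_nbrs_pos[OF _ d, of x] by (metis Suc_leI of_nat_1 of_nat_mono One_nat_def)
    then show "emeasure (srw d n x) {X. X k = z} \<le> of_nat (card (nbrs d n x)) * emeasure (srw d n x) {X. X k = z}"
      using mult_right_mono[of 1 "of_nat (card (nbrs d n x))" "emeasure (srw d n x) {X. X k = z}"] by simp
  qed
  also have "\<dots> \<le> of_nat (card (nbrs d n z))" by (rule sum_srw_reversed[OF assms])
  also have "\<dots> \<le> of_nat (d + 1)" using card_nbrs_le[OF z] by (rule of_nat_mono)
  also have "\<dots> = ennreal (real d + 1)" by (simp add: ennreal_of_nat_eq_real_of_nat add.commute)
  finally show ?thesis .
qed


section \<open>Chains of frogs\<close>

text \<open>A chain is recorded as a list of moves. A move goes to a vertex and possibly hands over to a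
  frog that lives there, given by its index.\<close>

type_synonym move = "vertex \<times> nat option"

text \<open>Here \<open>f\<close> is the frog that carries the chain, and \<open>k\<close> its own time, counted from its wake-up.
  After a hand-over the new frog starts at its time \<open>0\<close>.\<close>

fun follows :: "(vertex \<Rightarrow> nat) \<Rightarrow> (frog \<Rightarrow> nat \<Rightarrow> vertex) \<Rightarrow> frog \<Rightarrow> nat \<Rightarrow> move list \<Rightarrow> bool" where
  "follows \<eta> X f k [] = True"
| "follows \<eta> X f k ((z, None) # ms) \<longleftrightarrow> X f (Suc k) = z \<and> follows \<eta> X f (Suc k) ms"
| "follows \<eta> X f k ((z, Some i) # ms) \<longleftrightarrow>
     X f (Suc k) = z \<and> i < frogs_at \<eta> z \<and> X (z, i) 0 = z \<and> follows \<eta> X (z, i) 0 ms"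

fun carrier_after :: "frog \<Rightarrow> nat \<Rightarrow> move list \<Rightarrow> frog \<times> nat" where
  "carrier_after f k [] = (f, k)"
| "carrier_after f k ((z, None) # ms) = carrier_after f (Suc k) ms"
| "carrier_after f k ((z, Some i) # ms) = carrier_after (z, i) 0 ms"

fun end_vertex :: "vertex \<Rightarrow> move list \<Rightarrow> vertex" where
  "end_vertex y [] = y"
| "end_vertex y ((z, m) # ms) = end_vertex z ms"

text \<open>A hand-over is admitted only after a step down. This keeps the factor \<open>1 + \<mu>\<close> away from steps up;
  with this factor on all steps the weights would fail to contract for large \<open>d\<close> and \<open>\<mu> = d / 100\<close>.\<close>

fun route :: "nat \<Rightarrow> nat \<Rightarrow> vertex \<Rightarrow> move list \<Rightarrow> bool" where
  "route d n y [] = True"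
| "route d n y ((z, m) # ms) \<longleftrightarrow>
     z \<in> nbrs d n y \<and> (m \<noteq> None \<longrightarrow> length y < length z) \<and> route d n z ms"

definition switches :: "move list \<Rightarrow> vertex list" where
  "switches ms = map fst (filter (\<lambda>m. snd m \<noteq> None) ms)"

lemma switches_simps [simp]:
  "switches [] = []" "switches ((z, None) # ms) = switches ms"
  "switches ((z, Some i) # ms) = z # switches ms" "switches (ms @ ms') = switches ms @ switches ms'"
  by (simp_all add: switches_def)

lemma follows_append:
  "follows \<eta> X f k (ms @ ms') \<longleftrightarrow> follows \<eta> X f k ms \<and>
     (case carrier_after f k ms of (g, l) \<Rightarrow> follows \<eta> X g l ms')"
  by (induction \<eta> X f k ms rule: follows.induct) auto

lemma end_vertex_append [simp]: "end_vertex y (ms @ ms') = end_vertex (end_vertex y ms) ms'"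
  by (induction y ms rule: end_vertex.induct) auto

lemma route_append [simp]:
  "route d n y (ms @ ms') \<longleftrightarrow> route d n y ms \<and> route d n (end_vertex y ms) ms'"
  by (induction y ms rule: end_vertex.induct) auto

lemma route_in_tree:
  "route d n y ms \<Longrightarrow> y \<in> tree_verts d n \<Longrightarrow> end_vertex y ms \<in> tree_verts d n"
  by (induction y ms rule: end_vertex.induct) (auto simp: nbrs_def)

lemma carrier_at_end_vertex:
  "follows \<eta> X f k ms \<Longrightarrow> X f k = y \<Longrightarrow> carrier_after f k ms = (g, l) \<Longrightarrow> X g l = end_vertex y ms"
  by (induction \<eta> X f k ms arbitrary: y rule: follows.induct) auto

text \<open>The carrier at the end of a chain is either the initial one or one of the frogs to which the
  chain was handed over, and in the second case its own time is smaller than the length of the chain. This is all that is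
  remembered of a long excursion.\<close>

lemma carrier_after_cases:
  assumes "follows \<eta> X f k ms" "carrier_after f k ms = (g, l)"
  shows "(g = f \<and> l = k + length ms) \<or>
    (l < length ms \<and> fst g \<in> set (switches ms) \<and> snd g < frogs_at \<eta> (fst g))"
  using assms
proof (induction \<eta> X f k ms rule: follows.induct)
  case (3 \<eta> X f k z i ms)
  then show ?case by (cases "g = (z, i) \<and> l = length ms") auto
qed auto

lemma switches_route:
  "route d n y ms \<Longrightarrow> set (switches ms) \<subseteq> nonroot_verts d n"
proof (induction y ms rule: end_vertex.induct)
  case (2 y z m ms)
  then have "z \<in> tree_verts d n" by (auto simp: nbrs_def)
  then show ?case using 2 by (cases m) (auto simp: nonroot_verts_def)
qed simp

definition walk_moves :: "(nat \<Rightarrow> vertex) \<Rightarrow> nat \<Rightarrow> nat \<Rightarrow> move list" where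
  "walk_moves Y k m = map (\<lambda>r. (Y r, None)) [Suc k..<Suc (k + m)]"

lemma walk_moves_simps:
  "walk_moves Y k 0 = []"
  "walk_moves Y k (Suc m) = (Y (Suc k), None) # walk_moves Y (Suc k) m"
  by (simp_all add: walk_moves_def upt_conv_Cons del: upt_Suc)

lemma walk_moves_props:
  shows "follows \<eta> X f k (walk_moves (X f) k m)"
    and "switches (walk_moves Y k m) = []"
    and "end_vertex (Y k) (walk_moves Y k m) = Y (k + m)"
    and "length (walk_moves Y k m) = m"
    and "(\<And>t. Y (Suc t) \<in> nbrs d n (Y t)) \<Longrightarrow> route d n (Y k) (walk_moves Y k m)"
  by (induction m arbitrary: k) (auto simp: walk_moves_simps)

lemma end_vertex_take_walk_moves:
  "r \<le> m \<Longrightarrow> end_vertex (Y k) (take r (walk_moves Y k m)) = Y (k + r)"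
proof (induction m arbitrary: k r)
  case (Suc m) then show ?case by (cases r) (auto simp: walk_moves_simps)
qed (simp add: walk_moves_simps)

text \<open>In a tree, a route from the root to a vertex visits all its ancestors. Consequently a vertex that
  is visited for the first time cannot be entered from a child.\<close>

lemma route_passes_ancestors:
  assumes "route d n [] ms" "\<exists>w. end_vertex [] ms = w @ x"
  shows "\<exists>r\<le>length ms. end_vertex [] (take r ms) = x"
  using assms
proof (induction ms rule: rev_induct)
  case Nil then show ?case by simp
next
  case (snoc m ms)
  obtain z o' where m: "m = (z, o')" by (cases m)
  let ?y = "end_vertex [] ms"
  have z: "z \<in> nbrs d n ?y" using snoc.prems m by simp
  obtain w where w: "z = w @ x" using snoc.prems m by auto
  show ?case
  proof (cases "w = []")
    case True
    then show ?thesis using w m by (intro exI[of _ "Suc (length ms)"]) simp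
  next
    case False
    have "\<exists>w. ?y = w @ x"
    proof (cases "\<exists>i. z = i # ?y")
      case True
      then show ?thesis using w False by (cases w) (auto intro!: exI[of _ "tl w"])
    next
      case False
      then obtain i where "?y = i # z" using z by (auto simp: nbrs_def)
      then show ?thesis using w by (metis append_Cons)
    qed
    then obtain r where "r \<le> length ms" "end_vertex [] (take r ms) = x" using snoc by auto
    then show ?thesis by (intro exI[of _ r]) simp
  qed
qed

lemma switches_visited:
  "x \<in> set (switches ms) \<Longrightarrow> \<exists>r\<le>length ms. end_vertex y (take r ms) = x"
proof (induction y ms rule: end_vertex.induct)
  case (2 y z m ms)
  show ?case
  proof (cases "x = z")
    case True then show ?thesis by (intro exI[of _ 1]) auto
  next
    case False
    then have "x \<in> set (switches ms)" using 2 by (cases m) auto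
    then obtain r where "r \<le> length ms" "end_vertex z (take r ms) = x" using 2 by auto
    then show ?thesis by (intro exI[of _ "Suc r"]) auto
  qed
qed simp

abbreviation visited :: "(vertex \<Rightarrow> nat) \<Rightarrow> (frog \<Rightarrow> nat \<Rightarrow> vertex) \<Rightarrow> nat \<Rightarrow> vertex \<Rightarrow> bool" where
  "visited \<eta> X t v \<equiv> first_visit \<eta> X t v \<noteq> None"

lemma first_visit_mono: "first_visit \<eta> X t v = Some s \<Longrightarrow> t \<le> t' \<Longrightarrow> first_visit \<eta> X t' v = Some s"
proof (induction t')
  case (Suc t')
  then show ?case by (cases "t \<le> t'") (auto simp: le_Suc_eq simp del: first_visit.simps(2), simp)
qed simp

lemma visited_mono: "visited \<eta> X t v \<Longrightarrow> t \<le> t' \<Longrightarrow> visited \<eta> X t' v"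
  using first_visit_mono by blast

lemma first_visit_cases:
  assumes "first_visit \<eta> X t v = Some s"
  shows "s \<le> t \<and> first_visit \<eta> X s v = Some s \<and> ((s = 0 \<and> v = []) \<or> (0 < s \<and> \<not> visited \<eta> X (s - 1) v \<and>
    (\<exists>u s' i. s' < s \<and> first_visit \<eta> X (s - 1) u = Some s' \<and> i < frogs_at \<eta> u \<and> X (u, i) (s - s') = v)))"
  using assms
proof (induction t arbitrary: v s)
  case 0 then show ?case by (auto split: if_splits)
next
  case (Suc t)
  show ?case
  proof (cases "first_visit \<eta> X t v")
    case (Some s'')
    then have "first_visit \<eta> X t v = Some s" using Suc.prems by simp
    then show ?thesis using Suc.IH[of v s] by auto
  next
    case None
    then obtain u s' i where *: "s = Suc t" "first_visit \<eta> X t u = Some s'" "i < frogs_at \<eta> u"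
        "X (u, i) (Suc t - s') = v"
      using Suc.prems by (auto split: if_splits)
    then have "s' \<le> t" using Suc.IH[of u s'] by blast
    moreover have "0 < s \<and> \<not> visited \<eta> X (s - 1) v \<and> s' < s \<and> first_visit \<eta> X (s - 1) u = Some s' \<and>
        i < frogs_at \<eta> u \<and> X (u, i) (s - s') = v"
      using * None \<open>s' \<le> t\<close> by simp
    ultimately show ?thesis using Suc.prems *(1) by blast
  qed
qed

lemma walk_visits:
  assumes "first_visit \<eta> X t u = Some s" "i < frogs_at \<eta> u" "X (u, i) 0 = u"
  shows "visited \<eta> X (s + r) (X (u, i) r)"
proof (cases r)
  case 0
  then show ?thesis using assms first_visit_cases[OF assms(1)] by auto
next
  case (Suc r')
  have "first_visit \<eta> X (s + r') u = Some s"
    using first_visit_cases[OF assms(1)] first_visit_mono[of \<eta> X s u s "s + r'"] by auto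
  then have "\<exists>u' s' i'. first_visit \<eta> X (s + r') u' = Some s' \<and> i' < frogs_at \<eta> u' \<and>
      X (u', i') (Suc (s + r') - s') = X (u, i) r"
    using assms(2) Suc by (intro exI[of _ u] exI[of _ s] exI[of _ i]) auto
  then show ?thesis unfolding Suc by (auto split: option.split)
qed

definition regular :: "nat \<Rightarrow> nat \<Rightarrow> (frog \<Rightarrow> nat \<Rightarrow> vertex) \<Rightarrow> bool" where
  "regular d n X \<longleftrightarrow> (\<forall>v\<in>tree_verts d n. \<forall>i. walks d n v (X (v, i)))"

text \<open>Follow the frog that visits \<open>v\<close> first back to its wake-up, and continue with the first visit to
  its home. The new hand-over is at a vertex that is not visited before, so it differs from all earlier ones
  and comes after a step down. The last two conjuncts carry the induction: the first shows that the
  earlier vertices are visited before, and the second exposes the move at which the hand-over takes place.\<close>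

lemma first_visit_route:
  assumes reg: "regular d n X"
  assumes "first_visit \<eta> X t v = Some s"
  shows "\<exists>ms. length ms = s \<and> route d n [] ms \<and> distinct (switches ms) \<and>
    follows \<eta> X ([], 0) 0 ms \<and> end_vertex [] ms = v \<and>
    (\<forall>r\<le>s. visited \<eta> X r (end_vertex [] (take r ms))) \<and>
    (s > 0 \<longrightarrow> (\<exists>ms'. ms = ms' @ [(v, None)]))"
  using assms(2)
proof (induction s arbitrary: t v rule: less_induct)
  case (less s)
  have root: "[] \<in> tree_verts d n" by (simp add: tree_verts_def)
  note fv = first_visit_cases[OF less.prems]
  show ?case
  proof (cases "s = 0")
    case True
    then show ?thesis using fv by (intro exI[of _ "[]"]) auto
  next
    case False
    then obtain u s' i where u: "s' < s" "first_visit \<eta> X (s - 1) u = Some s'" "i < frogs_at \<eta> u"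
        "X (u, i) (s - s') = v"
      using fv by auto
    define m where "m = s - s'"
    obtain m0 where m0: "m = Suc m0" using u(1) m_def by (metis Suc_pred zero_less_diff)
    let ?w = "walk_moves (X (u, i)) 0 m"
    have "X (u, i) (Suc m0) = v" using u(4) m0 m_def by metis
    then have wm: "?w = walk_moves (X (u, i)) 0 m0 @ [(v, None)]"
      unfolding m0 by (simp add: walk_moves_def)
    obtain ms0 where ms0: "length ms0 = s'" "route d n [] ms0" "distinct (switches ms0)"
        "follows \<eta> X ([], 0) 0 ms0" "end_vertex [] ms0 = u"
        "\<forall>r\<le>s'. visited \<eta> X r (end_vertex [] (take r ms0))"
        "s' > 0 \<longrightarrow> (\<exists>ms'. ms0 = ms' @ [(u, None)])"
      using less.IH[OF u(1,2)] by blast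
    have ut: "u \<in> tree_verts d n" using route_in_tree[OF ms0(2) root] ms0(5) by simp
    have wk: "walks d n u (X (u, i))" using reg ut unfolding regular_def by blast
    then have X0: "X (u, i) 0 = u" and wk': "\<And>t. X (u, i) (Suc t) \<in> nbrs d n (X (u, i) t)"
      by (auto simp: walks_def)
    have w: "route d n u ?w" "end_vertex u ?w = v"
      using walk_moves_props(5)[of "X (u, i)" d n 0 m, OF wk'] walk_moves_props(3)[of "X (u, i)" 0 m] X0 u(4) m_def
      by auto
    have wvis: "visited \<eta> X (s' + r) (end_vertex u (take r ?w))" if "r \<le> m" for r
      using walk_visits[OF u(2,3) X0, of r] end_vertex_take_walk_moves[OF that, of "X (u,i)" 0] X0 by simp
    show ?thesis
    proof (cases "s' = 0")
      case True
      then have u0: "u = []" "ms0 = []" "i = 0" using ms0(1,5) u(3) by (auto simp: frogs_at_def)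
      show ?thesis
      proof (rule exI[of _ ?w], intro conjI allI impI)
        show "\<exists>ms'. ?w = ms' @ [(v, None)]" using wm by blast
        show "follows \<eta> X ([], 0) 0 ?w" unfolding u0 by (rule walk_moves_props(1))
        show "visited \<eta> X r (end_vertex [] (take r ?w))" if "r \<le> s" for r
          using wvis[of r] u0 True m_def that by simp
      qed (use u0 True w m_def in \<open>simp_all add: walk_moves_props\<close>)
    next
      case False
      then obtain ms' where ms': "ms0 = ms' @ [(u, None)]" using ms0(7) by auto
      let ?ms = "ms' @ (u, Some i) # ?w"
      let ?x = "end_vertex [] ms'"
      have len: "Suc (length ms') = s'" using ms0(1) ms' by simp
      have vis': "visited \<eta> X (s' - 1) (end_vertex [] (take r ms'))" if "r \<le> length ms'" for r
        using ms0(6)[rule_format, of r] that len ms' visited_mono[of \<eta> X r _ "s' - 1"] by auto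
      have nvis: "\<not> visited \<eta> X (s' - 1) u"
        using first_visit_cases[OF u(2)] False by auto
      have xu: "u \<in> nbrs d n ?x" using ms0(2) ms' by simp
      (* The chain cannot arrive at u from a child, as it would have passed u before. *)
      have "\<not> (\<exists>a. ?x = a # u)"
      proof
        assume "\<exists>a. ?x = a # u"
        then have "\<exists>w. ?x = w @ u" by (metis append_Cons append_Nil)
        then obtain r where "r \<le> length ms'" "end_vertex [] (take r ms') = u"
          using route_passes_ancestors[of d n ms' u] ms0(2) ms' by auto
        then show False using vis' nvis by blast
      qed
      then have down: "length ?x < length u" using xu by (auto simp: nbrs_def)
      have fresh: "u \<notin> set (switches ms')"
        using switches_visited[of u ms' "[]"] vis' nvis by blast
      have vis: "visited \<eta> X r (end_vertex [] (take r ?ms))" if "r \<le> s" for r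
      proof (cases "r < s'")
        case True
        then show ?thesis using ms0(6)[rule_format, of r] len ms' by (auto simp: take_Cons')
      next
        case False
        define r' where "r' = r - s'"
        have r': "r = s' + r'" "r' \<le> m" using False that m_def u(1) r'_def by auto
        have "r - length ms' = Suc r'" using r' len by auto
        then have "take r ?ms = ms' @ (u, Some i) # take r' ?w" using r' len by simp
        then show ?thesis using wvis[OF r'(2)] r' by simp
      qed
      have "follows \<eta> X ([], 0) 0 ?ms"
        using ms0(4) ms' u(3) X0 walk_moves_props(1)[of \<eta> X "(u, i)" 0 m]
        by (auto simp: follows_append split: prod.splits)
      moreover have "length ?ms = s" using len m_def u(1) by (simp add: walk_moves_props)
      moreover have "\<exists>ms'. ?ms = ms' @ [(v, None)]" unfolding wm by auto
      moreover have "route d n [] ?ms" "distinct (switches ?ms)" "end_vertex [] ?ms = v"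
        using ms0(2,3) ms' w down fresh xu by (simp_all add: walk_moves_props)
      ultimately show ?thesis using vis by blast
    qed
  qed
qed


section \<open>Joint laws of finitely many frogs\<close>

text \<open>For each vertex \<open>u\<close> of a finite set \<open>U\<close>, one frog \<open>(u, \<iota> u)\<close> is required to exist and its walk to
  satisfy \<open>A u\<close>. As the vertices are distinct, all requirements are independent.\<close>

definition history :: "vertex set \<Rightarrow> (vertex \<Rightarrow> nat) \<Rightarrow> (vertex \<Rightarrow> (nat \<Rightarrow> vertex) set) \<Rightarrow>
    ((vertex \<Rightarrow> nat) \<times> (frog \<Rightarrow> nat \<Rightarrow> vertex)) set" where
  "history U \<iota> A = {\<omega>. \<forall>u\<in>U. \<iota> u < frogs_at (fst \<omega>) u \<and> snd \<omega> (u, \<iota> u) \<in> A u}"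

definition frog_exists_prob :: "(vertex \<Rightarrow> nat pmf) \<Rightarrow> vertex \<Rightarrow> nat \<Rightarrow> ennreal" where
  "frog_exists_prob p u i = (if u = [] then if i = 0 then 1 else 0 else emeasure (measure_pmf (p u)) {i<..})"

definition history_prob :: "nat \<Rightarrow> nat \<Rightarrow> (vertex \<Rightarrow> nat pmf) \<Rightarrow> vertex set \<Rightarrow> (vertex \<Rightarrow> nat) \<Rightarrow>
    (vertex \<Rightarrow> (nat \<Rightarrow> vertex) set) \<Rightarrow> ennreal" where
  "history_prob d n p U \<iota> A = (\<Prod>u\<in>U. frog_exists_prob p u (\<iota> u) * emeasure (srw d n u) (A u))"

lemma history_measurable:
  assumes "finite U" "U \<subseteq> tree_verts d n" "\<And>u. u \<in> U \<Longrightarrow> A u \<in> sets path_space"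
  shows "history U \<iota> A \<inter> space (frog_model d n p) \<in> sets (frog_model d n p)"
proof -
  let ?M = "frog_model d n p"
  note measurable_coords[measurable]
  have [measurable]: "Measurable.pred ?M (\<lambda>\<omega>. \<iota> u < frogs_at (fst \<omega>) u)" for u
    unfolding frogs_at_def by (cases "u = []") auto
  have "Measurable.pred ?M (\<lambda>\<omega>. snd \<omega> (u, \<iota> u) \<in> A u)" if "u \<in> U" for u
  proof -
    have "(\<lambda>x. x (u, \<iota> u)) \<in> measurable (\<Pi>\<^sub>M f\<in>tree_verts d n \<times> (UNIV :: nat set). path_space) path_space"
      by (rule measurable_component_singleton) (use that assms(2) in auto)
    then have "(\<lambda>\<omega>. snd \<omega> (u, \<iota> u)) \<in> measurable ((\<Pi>\<^sub>M v\<in>nonroot_verts d n. count_space (UNIV :: nat set)) \<Otimes>\<^sub>M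
     (\<Pi>\<^sub>M f\<in>tree_verts d n \<times> UNIV. path_space)) path_space"
      by (rule measurable_compose[OF measurable_snd])
    then have "(\<lambda>\<omega>. snd \<omega> (u, \<iota> u)) \<in> measurable ?M path_space"
      using measurable_cong_sets[OF sets_frog_model refl] by blast
    then show ?thesis using assms(3)[OF that] by measurable
  qed
  then have "Measurable.pred ?M (\<lambda>\<omega>. \<forall>u\<in>U. \<iota> u < frogs_at (fst \<omega>) u \<and> snd \<omega> (u, \<iota> u) \<in> A u)"
    using assms(1) by (intro pred_intros_finite pred_intros_logic) auto
  then show ?thesis unfolding history_def pred_def by (simp add: Int_def conj_commute)
qed

lemma emeasure_history:
  assumes U: "finite U" "U \<subseteq> tree_verts d n" and A: "\<And>u. u \<in> U \<Longrightarrow> A u \<in> sets path_space"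
  shows "emeasure (frog_model d n p) (history U \<iota> A \<inter> space (frog_model d n p)) = history_prob d n p U \<iota> A"
proof (cases "[] \<in> U \<and> \<iota> [] \<noteq> 0")
  case True
  then have "history U \<iota> A = {}" unfolding history_def by (auto simp: frogs_at_def)
  moreover have "history_prob d n p U \<iota> A = 0"
    unfolding history_prob_def using True U(1) by (auto simp: frog_exists_prob_def intro!: prod_zero)
  ultimately show ?thesis by simp
next
  case False
  let ?P = "\<Pi>\<^sub>M v\<in>nonroot_verts d n. measure_pmf (p v)"
  let ?Q = "\<Pi>\<^sub>M (v, i)\<in>tree_verts d n \<times> (UNIV :: nat set). srw d n v"
  interpret P: product_prob_space "\<lambda>v. measure_pmf (p v)" "nonroot_verts d n"
    by (rule product_prob_spaceI) (rule prob_space_measure_pmf)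
  interpret Q: product_prob_space "\<lambda>(v, i :: nat). srw d n v" "tree_verts d n \<times> (UNIV :: nat set)"
    by (rule product_prob_spaceI) (auto simp: prob_space_srw)
  let ?V = "U - {[]}" and ?W = "(\<lambda>u. (u, \<iota> u)) ` U"
  let ?S = "{\<eta> \<in> space ?P. \<forall>u\<in>?V. \<eta> u \<in> {\<iota> u<..}}"
  let ?T = "{X \<in> space ?Q. \<forall>f\<in>?W. X f \<in> A (fst f)}"
  have V: "?V \<subseteq> nonroot_verts d n" using U(2) by (auto simp: nonroot_verts_def)
  have eq: "history U \<iota> A \<inter> space (frog_model d n p) = ?S \<times> ?T"
    unfolding history_def frog_model_def space_pair_measure frogs_at_def using False by auto
  have S: "emeasure ?P ?S = (\<Prod>u\<in>?V. emeasure (measure_pmf (p u)) {\<iota> u<..})"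
    by (rule P.emeasure_PiM_Collect) (use U V in auto)
  have inj: "inj_on (\<lambda>u. (u, \<iota> u)) U" by (auto simp: inj_on_def)
  have "emeasure ?Q ?T = (\<Prod>f\<in>?W. emeasure (case f of (v, i) \<Rightarrow> srw d n v) (A (fst f)))"
    by (rule Q.emeasure_PiM_Collect) (use U A in \<open>auto simp: sets_srw\<close>)
  also have "\<dots> = (\<Prod>u\<in>U. emeasure (srw d n u) (A u))"
    by (subst prod.reindex[OF inj]) simp
  finally have T: "emeasure ?Q ?T = (\<Prod>u\<in>U. emeasure (srw d n u) (A u))" .
  have Ss: "?S \<in> sets ?P"
  proof (rule sets.sets_Collect_finite_All)
    fix u assume "u \<in> ?V"
    then have "(\<lambda>\<eta>. \<eta> u) \<in> measurable ?P (measure_pmf (p u))"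
      using V by (intro measurable_component_singleton) auto
    from measurable_sets[OF this, of "{\<iota> u<..}"]
    show "{\<eta> \<in> space ?P. \<eta> u \<in> {\<iota> u<..}} \<in> sets ?P" by (simp add: vimage_def Int_def conj_commute)
  qed (use U in auto)
  have Ts: "?T \<in> sets ?Q"
  proof (rule sets.sets_Collect_finite_All)
    fix f assume f: "f \<in> ?W"
    have "(\<lambda>X. X f) \<in> measurable ?Q (case f of (v, i) \<Rightarrow> srw d n v)"
      using f U by (intro measurable_component_singleton) auto
    from measurable_sets[OF this, of "A (fst f)"] f A
    show "{X \<in> space ?Q. X f \<in> A (fst f)} \<in> sets ?Q"
      by (auto simp: vimage_def Int_def conj_commute case_prod_beta sets_srw)
  qed (use U in auto)
  have "emeasure (?P \<Otimes>\<^sub>M ?Q) (?S \<times> ?T) = emeasure ?P ?S * emeasure ?Q ?T"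
    by (rule Q.emeasure_pair_measure_Times[OF Ss Ts])
  also have "\<dots> = (\<Prod>u\<in>U. frog_exists_prob p u (\<iota> u)) * (\<Prod>u\<in>U. emeasure (srw d n u) (A u))"
  proof -
    have "(\<Prod>u\<in>?V. emeasure (measure_pmf (p u)) {\<iota> u<..}) = (\<Prod>u\<in>?V. frog_exists_prob p u (\<iota> u))"
      by (intro prod.cong) (auto simp: frog_exists_prob_def)
    also have "\<dots> = (\<Prod>u\<in>U. frog_exists_prob p u (\<iota> u))"
      using U(1) False by (intro prod.mono_neutral_left) (auto simp: frog_exists_prob_def)
    finally show ?thesis using S T by simp
  qed
  finally show ?thesis unfolding eq by (simp add: frog_model_def history_prob_def prod.distrib)
qed

lemma suminf_frog_exists_prob_le:
  assumes "u \<noteq> []" "integrable (measure_pmf (p u)) real" "measure_pmf.expectation (p u) real \<le> \<mu>"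
  shows "(\<Sum>i. frog_exists_prob p u i) \<le> ennreal \<mu>"
proof -
  have "(\<Sum>i. frog_exists_prob p u i) = (\<Sum>i. emeasure (measure_pmf (p u)) {x \<in> space (measure_pmf (p u)). enat i < enat x})"
    unfolding frog_exists_prob_def using assms(1) by (simp add: greaterThan_def)
  also have "\<dots> = (\<integral>\<^sup>+x. ennreal_of_enat (enat x) \<partial>measure_pmf (p u))"
    by (rule nn_integral_enat_function[symmetric]) simp
  also have "\<dots> = (\<integral>\<^sup>+x. ennreal (real x) \<partial>measure_pmf (p u))"
    by (simp add: ennreal_of_nat_eq_real_of_nat)
  also have "\<dots> = ennreal (measure_pmf.expectation (p u) real)"
    by (rule nn_integral_eq_integral[OF assms(2)]) simp
  finally show ?thesis using assms(3) by (simp add: ennreal_leI)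
qed

lemma history_prob_update:
  assumes "finite U" "u \<in> U" "emeasure (srw d n u) B \<le> emeasure (srw d n u) (A u) * c"
  shows "history_prob d n p U \<iota> (A(u := B)) \<le> history_prob d n p U \<iota> A * c"
proof -
  let ?g = "\<lambda>A u. frog_exists_prob p u (\<iota> u) * emeasure (srw d n u) (A u)"
  have "(\<Prod>x\<in>U. ?g (A(u := B)) x) = ?g (A(u := B)) u * (\<Prod>x\<in>U - {u}. ?g (A(u := B)) x)"
    by (rule prod.remove[OF assms(1,2)])
  also have "(\<Prod>x\<in>U - {u}. ?g (A(u := B)) x) = (\<Prod>x\<in>U - {u}. ?g A x)"
    by (rule prod.cong) auto
  also have "?g (A(u := B)) u * (\<Prod>x\<in>U - {u}. ?g A x) \<le> (?g A u * c) * (\<Prod>x\<in>U - {u}. ?g A x)"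
    using mult_left_mono[OF assms(3), of "frog_exists_prob p u (\<iota> u)"]
    by (intro mult_right_mono) (auto simp: mult.assoc)
  also have "\<dots> = (\<Prod>x\<in>U. ?g A x) * c"
    by (subst prod.remove[OF assms(1,2)]) (simp add: ac_simps)
  finally show ?thesis unfolding history_prob_def .
qed

lemma history_prob_insert:
  assumes "finite U" "x \<notin> U"
  shows "history_prob d n p (insert x U) (\<iota>(x := i)) (A(x := B)) =
    history_prob d n p U \<iota> A * (frog_exists_prob p x i * emeasure (srw d n x) B)"
proof -
  have "(\<Prod>u\<in>U. frog_exists_prob p u ((\<iota>(x := i)) u) * emeasure (srw d n u) ((A(x := B)) u)) =
      (\<Prod>u\<in>U. frog_exists_prob p u (\<iota> u) * emeasure (srw d n u) (A u))"
    by (rule prod.cong) (use assms in auto)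
  then show ?thesis unfolding history_prob_def using assms by (simp add: ac_simps)
qed

lemma follows_measurable:
  "Measurable.pred (frog_model d n p) (\<lambda>\<omega>. follows (fst \<omega>) (snd \<omega>) f k ms)"
proof (induction ms arbitrary: f k)
  case (Cons m ms)
  obtain z o' where m: "m = (z, o')" by (cases m)
  note measurable_coords[measurable] Cons.IH[measurable]
  have [measurable]: "Measurable.pred (frog_model d n p) (\<lambda>\<omega>. i < frogs_at (fst \<omega>) u)" for u i
    unfolding frogs_at_def by (cases "u = []") auto
  show ?case
  proof (cases o')
    case None
    show ?thesis unfolding m None follows.simps by measurable
  next
    case (Some i)
    show ?thesis unfolding m Some follows.simps by measurable
  qed
qed simp

lemma AE_regular:
  assumes "d \<ge> 1" "n \<ge> 1"
  shows "AE \<omega> in frog_model d n p. regular d n (snd \<omega>)"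
proof -
  let ?P = "\<Pi>\<^sub>M v\<in>nonroot_verts d n. measure_pmf (p v)"
  let ?Q = "\<Pi>\<^sub>M (v, i)\<in>tree_verts d n \<times> (UNIV :: nat set). srw d n v"
  interpret P: prob_space ?P by (rule prob_space_PiM) (rule prob_space_measure_pmf)
  interpret Q: prob_space ?Q by (rule prob_space_PiM) (auto simp: prob_space_srw)
  interpret pair_sigma_finite ?P ?Q ..
  have "AE X in ?Q. walks d n (fst f) (X f)" if "f \<in> tree_verts d n \<times> UNIV" for f
  proof -
    have "AE X in (case f of (v, i) \<Rightarrow> srw d n v). walks d n (fst f) X"
      using AE_srw_walks[of "fst f" d n] that assms unfolding case_prod_beta by auto
    from AE_PiM_component[where i=f and I="tree_verts d n \<times> UNIV" and M="\<lambda>(v, i). srw d n v", OF _ that this]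
    show ?thesis by (simp add: case_prod_beta prob_space_srw)
  qed
  then have "AE X in ?Q. \<forall>f. f \<in> tree_verts d n \<times> UNIV \<longrightarrow> walks d n (fst f) (X f)"
    unfolding AE_all_countable by auto
  then have "AE X in ?Q. regular d n X"
    by eventually_elim (auto simp: regular_def)
  then have ae: "AE \<eta> in ?P. AE X in ?Q. regular d n (snd (\<eta>, X))" by simp
  have "Measurable.pred (frog_model d n p) (\<lambda>\<omega>. regular d n (snd \<omega>))"
  proof -
    note measurable_coords[measurable]
    show ?thesis unfolding regular_def walks_def using finite_tree_verts[of d n] by measurable
  qed
  then have "{\<omega> \<in> space (?P \<Otimes>\<^sub>M ?Q). regular d n (snd \<omega>)} \<in> sets (?P \<Otimes>\<^sub>M ?Q)"
    unfolding frog_model_def pred_def .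
  from AE_pair_measure[OF this ae] show ?thesis unfolding frog_model_def .
qed


section \<open>A potential for chains\<close>

text \<open>There are \<open>H\<close> zones of \<open>j\<close> levels above the leaves. The quotient in the assumptions is the
  contraction factor \<open>r\<close>, and the last assumption says that the gain \<open>r ^ j\<close> from crossing a zone
  twice pays for a jump.\<close>

locale scales =
  fixes d n j H :: nat and \<mu> :: real
  assumes d2: "d \<ge> 2" and mu0: "\<mu> \<ge> 0" and j2: "j \<ge> 2" and H1: "H * j + 2 \<le> n"
    and r_lt_1: "4 * real d * (1 + \<mu>) / (real d + 1)\<^sup>2 < 1"
    and jump_small: "2 ^ H * (1 + \<mu> * (real d + 1)) * (4 * real d * (1 + \<mu>) / (real d + 1)\<^sup>2) ^ j
      \<le> 2 / (real d + 1) * (1 - 4 * real d * (1 + \<mu>) / (real d + 1)\<^sup>2)\<^sup>2"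
begin

definition r :: real where "r = 4 * real d * (1 + \<mu>) / (real d + 1)\<^sup>2"
definition \<alpha> :: real where "\<alpha> = 2 / (real d + 1)"
definition \<beta> :: real where "\<beta> = (real d + 1) / (2 * real d * (1 + \<mu>))"
definition jump_cost :: real where "jump_cost = 2 ^ H * (1 + \<mu> * (real d + 1))"

text \<open>The weight of a jump from the lower end of a zone must be absorbed by the difference between a solution of rate \<open>\<beta>\<close> at
  this end and \<open>\<alpha>\<close> times the same solution one level higher. The value is the one with
  \<open>jump_cost * \<alpha> ^ j = excess * (\<beta> - \<alpha>) * \<beta> ^ j\<close>.\<close>

definition excess :: real where "excess = jump_cost * r ^ j / (\<beta> - \<alpha>)"

lemma d_pos: "real d > 0" using d2 by simp

lemma r_pos: "r > 0" unfolding r_def using d_pos mu0 by (intro divide_pos_pos mult_pos_pos) auto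
lemma r_less: "r < 1" using r_lt_1 by (simp add: r_def)
lemma alpha_pos: "\<alpha> > 0" unfolding \<alpha>_def by simp
lemma beta_pos: "\<beta> > 0" unfolding \<beta>_def using d_pos mu0 by simp

lemma alpha_eq: "\<alpha> = r * \<beta>"
  unfolding r_def \<beta>_def \<alpha>_def using d_pos mu0 by (simp add: divide_simps power2_eq_square)

lemma alpha_less_beta: "\<alpha> < \<beta>"
  unfolding alpha_eq using r_less beta_pos by simp

lemma alpha_half: "1 / (real d + 1) = \<alpha> / 2"
  unfolding \<alpha>_def by (simp add: divide_simps)

lemma beta_half: "real d * (1 + \<mu>) / (real d + 1) * \<beta> = 1 / 2"
  unfolding \<beta>_def using d_pos mu0 by (simp add: divide_simps)

lemma jump_cost_nonneg: "jump_cost \<ge> 0" unfolding jump_cost_def using mu0 by simp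

lemma excess_nonneg: "excess \<ge> 0"
  unfolding excess_def using jump_cost_nonneg r_pos alpha_less_beta by simp

lemma excess_beta: "excess * \<beta> \<le> \<alpha> * (1 - r)"
proof -
  have "jump_cost * r ^ j \<le> \<alpha> * (1 - r)\<^sup>2"
    using jump_small by (simp add: jump_cost_def r_def \<alpha>_def)
  moreover have "excess * \<beta> = jump_cost * r ^ j / (1 - r)"
  proof -
    have "\<beta> - \<alpha> = \<beta> * (1 - r)" by (simp add: alpha_eq algebra_simps)
    then show ?thesis unfolding excess_def using beta_pos by simp
  qed
  ultimately show ?thesis using r_less by (simp add: divide_le_eq power2_eq_square mult.assoc)
qed

definition bias :: real where "bias = (1 + r) / 2"

text \<open>One step from level \<open>i + 1\<close>: to the parent with probability \<open>1 / (d + 1)\<close>, or to one of \<open>d\<close> children,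
  where the weight is multiplied by \<open>1 + \<mu>\<close>. The two numbers \<open>\<alpha>\<close> and \<open>\<beta>\<close> are those for which the step up, respectively the
  step down, contributes exactly one half.\<close>

lemma up_down_alpha: "(\<alpha> ^ i + real d * (1 + \<mu>) * \<alpha> ^ Suc (Suc i)) / (real d + 1) = bias * \<alpha> ^ Suc i"
proof -
  have "(\<alpha> ^ i + real d * (1 + \<mu>) * \<alpha> ^ Suc (Suc i)) / (real d + 1) =
      \<alpha> ^ i * (1 / (real d + 1)) + (real d * (1 + \<mu>) / (real d + 1) * \<beta>) * r * \<alpha> ^ Suc i"
    by (simp add: alpha_eq add_divide_distrib mult_ac)
  also have "\<dots> = bias * \<alpha> ^ Suc i" unfolding alpha_half beta_half bias_def by (simp add: algebra_simps)
  finally show ?thesis .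
qed

lemma up_down_beta: "(\<beta> ^ i + real d * (1 + \<mu>) * \<beta> ^ Suc (Suc i)) / (real d + 1) = bias * \<beta> ^ Suc i"
proof -
  have "(\<beta> ^ i + real d * (1 + \<mu>) * \<beta> ^ Suc (Suc i)) / (real d + 1) =
      \<beta> ^ i * (1 / (real d + 1)) + (real d * (1 + \<mu>) / (real d + 1) * \<beta>) * \<beta> ^ Suc i"
    by (simp add: add_divide_distrib mult_ac)
  also have "\<dots> = bias * \<beta> ^ Suc i" unfolding alpha_half beta_half bias_def alpha_eq by (simp add: algebra_simps)
  finally show ?thesis .
qed

lemma bias_bounds: "0 < bias" "bias < 1" using r_pos r_less by (auto simp: bias_def)

text \<open>Bound for the weight of leaving a zone through its top level, from \<open>i\<close> levels below that level. If \<open>b\<close>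
  holds, one jump is still possible and the second term provides for it. At the top level itself this
  term can be dropped, because the first step from there already contracts by \<open>bias\<close>. This restores
  the bound \<open>\<alpha>\<close> from one scale to the next.\<close>

definition zone_pot :: "bool \<Rightarrow> nat \<Rightarrow> real" where
  "zone_pot b i = \<alpha> ^ Suc i + (if b \<and> 1 \<le> i then excess * \<beta> ^ Suc i else 0)"

lemma zone_pot_nonneg: "zone_pot b i \<ge> 0"
  unfolding zone_pot_def using alpha_pos beta_pos excess_nonneg by auto

lemma zone_pot_0: "zone_pot b 0 = \<alpha>" by (simp add: zone_pot_def)

lemma zone_pot_interior: "(zone_pot b i + real d * (1 + \<mu>) * zone_pot b (Suc (Suc i))) / (real d + 1) \<le> zone_pot b (Suc i)"
proof -
  have le: "zone_pot b i \<le> \<alpha> ^ Suc i + (if b then excess * \<beta> ^ Suc i else 0)"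
    unfolding zone_pot_def using excess_nonneg beta_pos by auto
  have "(zone_pot b i + real d * (1 + \<mu>) * zone_pot b (Suc (Suc i))) / (real d + 1) \<le>
      ((\<alpha> ^ Suc i + (if b then excess * \<beta> ^ Suc i else 0)) + real d * (1 + \<mu>) * zone_pot b (Suc (Suc i))) / (real d + 1)"
    using le by (intro divide_right_mono add_right_mono) auto
  also have "\<dots> = (\<alpha> ^ Suc i + real d * (1 + \<mu>) * \<alpha> ^ Suc (Suc (Suc i))) / (real d + 1) +
      (if b then excess * ((\<beta> ^ Suc i + real d * (1 + \<mu>) * \<beta> ^ Suc (Suc (Suc i))) / (real d + 1)) else 0)"
    unfolding zone_pot_def by (simp add: add_divide_distrib distrib_left mult_ac)
  also have "\<dots> = bias * zone_pot b (Suc i)"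
    unfolding up_down_alpha up_down_beta zone_pot_def by (simp add: distrib_left mult_ac)
  also have "\<dots> \<le> zone_pot b (Suc i)"
    using bias_bounds zone_pot_nonneg[of b "Suc i"] by (simp add: mult_left_le_one_le)
  finally show ?thesis .
qed

lemma zone_pot_entry: "(1 + real d * (1 + \<mu>) * zone_pot b 1) / (real d + 1) \<le> zone_pot b 0"
proof -
  have "zone_pot b 1 \<le> \<alpha>\<^sup>2 + excess * \<beta>\<^sup>2"
    unfolding zone_pot_def using excess_nonneg beta_pos by (auto simp: power2_eq_square)
  then have "(1 + real d * (1 + \<mu>) * zone_pot b 1) / (real d + 1) \<le>
      (1 + real d * (1 + \<mu>) * (\<alpha>\<^sup>2 + excess * \<beta>\<^sup>2)) / (real d + 1)"
    using mu0 by (intro divide_right_mono add_left_mono mult_left_mono) auto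
  also have "\<dots> = (\<alpha> ^ 0 + real d * (1 + \<mu>) * \<alpha> ^ Suc (Suc 0)) / (real d + 1) +
      (real d * (1 + \<mu>) / (real d + 1) * \<beta>) * (excess * \<beta>)"
    by (simp add: add_divide_distrib distrib_left power2_eq_square mult_ac)
  also have "\<dots> = bias * \<alpha> + excess * \<beta> / 2"
    unfolding up_down_alpha beta_half by simp
  also have "\<dots> \<le> bias * \<alpha> + \<alpha> * (1 - r) / 2"
    using excess_beta by simp
  also have "\<dots> = zone_pot b 0" unfolding zone_pot_0 bias_def by (simp add: field_simps)
  finally show ?thesis .
qed

text \<open>At the lower end of a zone, a short excursion of the next scale costs \<open>\<alpha>\<close> and leads back one
  level up. A long one costs \<open>jump_cost\<close>, leads to the same vertex, and uses up the jump.\<close>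

lemma zone_pot_jump: "\<alpha> * zone_pot b (j - 1) + (if b then jump_cost * zone_pot False (j - 1) else 0) \<le> zone_pot b j"
proof -
  obtain k where k: "j = Suc k" "1 \<le> k" using j2 by (cases j) auto
  have ne: "\<beta> - \<alpha> > 0" using alpha_less_beta by simp
  have "jump_cost * \<alpha> ^ j = excess * (\<beta> - \<alpha>) * \<beta> ^ j"
    unfolding excess_def using ne by (simp add: power_mult_distrib) (simp add: alpha_eq power_mult_distrib)
  then show ?thesis
    unfolding zone_pot_def using k by (auto simp: algebra_simps)
qed

text \<open>Number of levels in the top zone. Vertices of level \<open>top_depth - 1\<close> are counted when they are visited.
  The constant below makes the contraction at that level account for one such visit.\<close>

definition top_depth :: nat where "top_depth = n - H * j"
definition top_const :: real where "top_const = 2 / ((1 - r) * \<beta> ^ (top_depth - 1))"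

lemma top_depth_ge: "top_depth \<ge> 2" unfolding top_depth_def using H1 by simp

lemma top_const_pos: "top_const > 0" unfolding top_const_def using r_less beta_pos by simp

lemma top_interior:
  "(if Suc l = top_depth - 1 then 1 else 0) + (top_const * \<beta> ^ l + real d * (1 + \<mu>) * (top_const * \<beta> ^ Suc (Suc l))) / (real d + 1)
    \<le> top_const * \<beta> ^ Suc l"
proof -
  have "(top_const * \<beta> ^ l + real d * (1 + \<mu>) * (top_const * \<beta> ^ Suc (Suc l))) / (real d + 1) =
      top_const * ((\<beta> ^ l + real d * (1 + \<mu>) * \<beta> ^ Suc (Suc l)) / (real d + 1))"
    by (simp add: distrib_left mult_ac)
  also have "\<dots> = top_const * bias * \<beta> ^ Suc l" unfolding up_down_beta by simp
  finally have *: "(top_const * \<beta> ^ l + real d * (1 + \<mu>) * (top_const * \<beta> ^ Suc (Suc l))) / (real d + 1) = top_const * bias * \<beta> ^ Suc l" .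
  have "top_const * bias * \<beta> ^ Suc l \<le> top_const * \<beta> ^ Suc l"
    using top_const_pos bias_bounds beta_pos by simp
  moreover have "1 = top_const * (1 - bias) * \<beta> ^ Suc l" if "Suc l = top_depth - 1"
    unfolding top_const_def that bias_def using r_less beta_pos by (simp add: field_simps)
  ultimately show ?thesis unfolding * by (cases "Suc l = top_depth - 1") (simp_all add: right_diff_distrib left_diff_distrib)
qed

text \<open>At the root all steps lead down, so that rate \<open>\<beta>\<close> has to be checked separately.\<close>

lemma top_root: "(1 + \<mu>) * (top_const * \<beta> ^ 1) \<le> top_const * \<beta> ^ 0"
proof -
  have "(1 + \<mu>) * \<beta> = (real d + 1) / (2 * real d)"
    unfolding \<beta>_def using d_pos mu0 by (simp add: divide_simps)
  also have "\<dots> \<le> 1" using d2 by simp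
  finally show ?thesis using top_const_pos by (simp add: mult.left_commute mult_left_le)
qed

text \<open>After leaving a subtree of scale \<open>h\<close>, a chain is one level above the lower end of zone \<open>h + 1\<close>,
  so it is at depth \<open>j - 1\<close> in that zone, and likewise for all larger scales in turn.\<close>

definition outer_pot :: "nat \<Rightarrow> (nat \<Rightarrow> bool) \<Rightarrow> real" where
  "outer_pot h b = (\<Prod>h'\<in>{h<..H}. zone_pot (b h') (j - 1)) * (top_const * \<beta> ^ (top_depth - 1))"

text \<open>Potential of a chain at level \<open>l\<close> of zone \<open>h\<close>; the top zone has number \<open>Suc H\<close>. The flag \<open>b h'\<close> tells whether
  a jump is still possible within the current subtree of scale \<open>h'\<close>.\<close>

definition pot :: "nat \<Rightarrow> (nat \<Rightarrow> bool) \<Rightarrow> nat \<Rightarrow> real" where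
  "pot h b l = (if h \<le> H then zone_pot (b h) (l - (n - h * j)) * outer_pot h b else top_const * \<beta> ^ l)"

lemma outer_pot_nonneg: "outer_pot h b \<ge> 0"
  unfolding outer_pot_def using zone_pot_nonneg top_const_pos beta_pos by (intro mult_nonneg_nonneg prod_nonneg) auto

lemma pot_nonneg: "pot h b l \<ge> 0"
  unfolding pot_def using zone_pot_nonneg outer_pot_nonneg top_const_pos beta_pos by simp

lemma level_arith:
  assumes "1 \<le> h" "h \<le> H"
  shows "n - (h - 1) * j = n - h * j + j" "n - h * j \<ge> top_depth" "n - h * j \<ge> 2"
proof -
  obtain h' where h': "h = Suc h'" using assms(1) by (cases h) auto
  have "h * j \<le> H * j" using assms by simp
  then show "n - (h - 1) * j = n - h * j + j" "n - h * j \<ge> top_depth" "n - h * j \<ge> 2"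
    using H1 unfolding h' top_depth_def by auto
qed

lemma outer_pot_Suc: "1 \<le> h \<Longrightarrow> h \<le> H \<Longrightarrow> outer_pot (h - 1) b = zone_pot (b h) (j - 1) * outer_pot h b"
proof -
  assume "1 \<le> h" "h \<le> H"
  then have "{h - 1<..H} = insert h {h<..H}" by auto
  then show ?thesis unfolding outer_pot_def by simp
qed

lemma outer_pot_cong: "(\<And>h'. h' > h \<Longrightarrow> b h' = b' h') \<Longrightarrow> outer_pot h b = outer_pot h b'"
  unfolding outer_pot_def by (intro arg_cong2[where f="(*)"] prod.cong) auto

lemma pot_exit:
  assumes "1 \<le> h" "h \<le> H"
  shows "pot (Suc h) b (n - h * j - 1) = outer_pot h b"
proof (cases "h = H")
  case True
  then show ?thesis by (simp add: pot_def outer_pot_def top_depth_def)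
next
  case False
  then have h: "1 \<le> Suc h" "Suc h \<le> H" using assms by auto
  have "n - h * j - 1 - (n - Suc h * j) = j - 1"
    using level_arith[OF h] j2 by simp
  then show ?thesis using outer_pot_Suc[OF h] h by (simp add: pot_def)
qed

text \<open>From the top level of a zone, a step up leads out of the subtree and into the zone of the next larger scale.\<close>

definition up_scale :: "nat \<Rightarrow> nat \<Rightarrow> nat" where
  "up_scale h l = (if h \<le> H \<and> l = n - h * j then Suc h else h)"

lemma pot_interior:
  assumes "1 \<le> h" "h \<le> H" "n - h * j \<le> l"
  shows "(pot (up_scale h l) b (l - 1) + real d * (1 + \<mu>) * pot h b (Suc l)) / (real d + 1) \<le> pot h b l"
proof (cases "l = n - h * j")
  case True
  have "pot (up_scale h l) b (l - 1) = outer_pot h b"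
    using pot_exit[OF assms(1,2)] True assms by (simp add: up_scale_def)
  then have "(pot (up_scale h l) b (l - 1) + real d * (1 + \<mu>) * pot h b (Suc l)) / (real d + 1) =
      (1 + real d * (1 + \<mu>) * zone_pot (b h) 1) / (real d + 1) * outer_pot h b"
    using True assms by (simp add: pot_def distrib_right)
  also have "\<dots> \<le> zone_pot (b h) 0 * outer_pot h b"
    by (rule mult_right_mono[OF zone_pot_entry outer_pot_nonneg])
  finally show ?thesis using True assms by (simp add: pot_def)
next
  case False
  then obtain i where i: "l = n - h * j + Suc i" using assms(3)
    by (metis le_neq_implies_less less_iff_Suc_add add_Suc_right)
  have "(pot (up_scale h l) b (l - 1) + real d * (1 + \<mu>) * pot h b (Suc l)) / (real d + 1) =
      (zone_pot (b h) i + real d * (1 + \<mu>) * zone_pot (b h) (Suc (Suc i))) / (real d + 1) * outer_pot h b"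
    using i assms by (simp add: pot_def up_scale_def distrib_right)
  also have "\<dots> \<le> zone_pot (b h) (Suc i) * outer_pot h b"
    by (rule mult_right_mono[OF zone_pot_interior outer_pot_nonneg])
  finally show ?thesis using i assms by (simp add: pot_def)
qed

lemma pot_top_interior:
  assumes "1 \<le> l"
  shows "(if l = top_depth - 1 then 1 else 0) + (pot (up_scale (Suc H) l) b (l - 1) + real d * (1 + \<mu>) * pot (Suc H) b (Suc l)) / (real d + 1)
    \<le> pot (Suc H) b l"
  using top_interior[of "l - 1"] assms by (simp add: pot_def up_scale_def)

lemma pot_root: "(1 + \<mu>) * pot (Suc H) b 1 \<le> pot (Suc H) b 0"
  using top_root by (simp add: pot_def)

lemma pot_jump:
  assumes "1 \<le> h" "h \<le> H" "l = n - (h - 1) * j"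
  shows "pot (h - 1) (b(h - 1 := True)) l + (if b h then jump_cost * pot h (b(h := False)) (l - 1) else 0) \<le> pot h b l"
proof -
  have l: "l - 1 - (n - h * j) = j - 1" "l - (n - h * j) = j"
    using level_arith[OF assms(1,2)] assms(3) j2 by auto
  have "outer_pot (h - 1) (b(h - 1 := True)) = outer_pot (h - 1) b" "outer_pot h (b(h := False)) = outer_pot h b"
    by (auto intro!: outer_pot_cong)
  then have "pot (h - 1) (b(h - 1 := True)) l = \<alpha> * zone_pot (b h) (j - 1) * outer_pot h b"
      "pot h (b(h := False)) (l - 1) = zone_pot False (j - 1) * outer_pot h b" "pot h b l = zone_pot (b h) j * outer_pot h b"
    using assms l outer_pot_Suc[OF assms(1,2)] by (auto simp: pot_def zone_pot_0)
  then have "pot (h - 1) (b(h - 1 := True)) l + (if b h then jump_cost * pot h (b(h := False)) (l - 1) else 0)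
      = (\<alpha> * zone_pot (b h) (j - 1) + (if b h then jump_cost * zone_pot False (j - 1) else 0)) * outer_pot h b"
    by (simp add: distrib_right)
  also have "\<dots> \<le> zone_pot (b h) j * outer_pot h b" by (rule mult_right_mono[OF zone_pot_jump outer_pot_nonneg])
  finally show ?thesis using \<open>pot h b l = zone_pot (b h) j * outer_pot h b\<close> by simp
qed

lemma pot_enter: "1 \<le> H \<Longrightarrow> pot H (b(H := True)) top_depth \<le> pot (Suc H) b top_depth"
proof -
  obtain k where k: "top_depth = Suc k" using top_depth_ge by (cases top_depth) auto
  have "pot H (b(H := True)) top_depth = \<alpha> * (top_const * \<beta> ^ k)"
    using k by (simp add: pot_def top_depth_def[symmetric] zone_pot_0 outer_pot_def)
  also have "\<dots> \<le> \<beta> * (top_const * \<beta> ^ k)"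
    using alpha_less_beta top_const_pos beta_pos by (intro mult_right_mono) auto
  finally show ?thesis using k by (simp add: pot_def mult_ac)
qed

end


section \<open>Weighing a chain step by step\<close>

text \<open>In a tree, the first time when a route from \<open>y\<close>
  gets above the level of \<open>y\<close>, it is at the parent of \<open>y\<close>. So exit from a subtree can be read off from levels.\<close>

definition exits :: "nat \<Rightarrow> nat \<Rightarrow> vertex \<Rightarrow> move list \<Rightarrow> bool" where
  "exits L t y ms \<longleftrightarrow> 1 \<le> t \<and> t \<le> length ms \<and> length (end_vertex y (take t ms)) < L"

lemma exits_Cons: "1 < t \<Longrightarrow> exits L t y ((z, m) # ms) \<longleftrightarrow> exits L (t - 1) z ms"
  by (cases t) (auto simp: exits_def)

lemma exits_drop: "s < t \<Longrightarrow> exits L t y ms \<Longrightarrow> exits L (t - s) (end_vertex y (take s ms)) (drop s ms)"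
proof -
  assume "s < t" "exits L t y ms"
  then have "take t ms = take s ms @ take (t - s) (drop s ms)"
    by (metis le_add_diff_inverse less_imp_le take_add)
  then have "end_vertex y (take t ms) = end_vertex (end_vertex y (take s ms)) (take (t - s) (drop s ms))"
    by simp
  then show ?thesis using \<open>s < t\<close> \<open>exits L t y ms\<close> by (auto simp: exits_def)
qed

lemma end_vertex_take_Suc:
  assumes "route d n y ms" "t < length ms"
  shows "end_vertex y (take (Suc t) ms) \<in> nbrs d n (end_vertex y (take t ms))"
proof -
  have *: "take (Suc t) ms = take t ms @ [ms ! t]" using assms(2) by (rule take_Suc_conv_app_nth)
  have "ms = take t ms @ ms ! t # drop (Suc t) ms" using assms(2) by (rule id_take_nth_drop)
  then have "route d n (end_vertex y (take t ms)) (ms ! t # drop (Suc t) ms)"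
    using assms(1) by (metis route_append)
  then show ?thesis unfolding * by (cases "ms ! t") auto
qed

text \<open>Until its first exit the route stays among the descendants of \<open>y\<close>.\<close>

lemma first_exit_to_parent:
  assumes "route d n y ms" "s \<le> length ms" "length (end_vertex y (take s ms)) < length y"
    and "\<And>t. t < s \<Longrightarrow> \<not> length (end_vertex y (take t ms)) < length y"
  shows "end_vertex y (take s ms) = tl y"
proof -
  have s: "s > 0" using assms(3) by (cases s) auto
  have below: "\<exists>w. end_vertex y (take t ms) = w @ y" if "t < s" for t
    using that
  proof (induction t)
    case (Suc t)
    then obtain w where w: "end_vertex y (take t ms) = w @ y" by auto
    have "end_vertex y (take (Suc t) ms) \<in> nbrs d n (w @ y)"
      using end_vertex_take_Suc[OF assms(1), of t] Suc.prems assms(2) w by simp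
    then consider i where "end_vertex y (take (Suc t) ms) = i # w @ y"
      | i where "w @ y = i # end_vertex y (take (Suc t) ms)" by (auto simp: nbrs_def)
    then show ?case
    proof cases
      case 2
      then have "w \<noteq> []" using assms(4)[OF Suc.prems] by (auto dest: arg_cong[of _ _ length])
      then show ?thesis using 2 by (cases w) (auto intro!: exI[of _ "tl w"])
    qed (metis append_Cons)
  qed simp
  obtain w where w: "end_vertex y (take (s - 1) ms) = w @ y" using below[of "s - 1"] s by auto
  have "end_vertex y (take s ms) \<in> nbrs d n (w @ y)"
    using end_vertex_take_Suc[OF assms(1), of "s - 1"] s assms(2) w by simp
  then consider i where "end_vertex y (take s ms) = i # w @ y"
    | i where "w @ y = i # end_vertex y (take s ms)" by (auto simp: nbrs_def)
  then show ?thesis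
  proof cases
    case 1 then show ?thesis using assms(3) by simp
  next
    case 2
    then show ?thesis
    proof (cases w)
      case (Cons a w')
      then have "end_vertex y (take s ms) = w' @ y" using 2 by simp
      then show ?thesis using assms(3) by simp
    qed (metis append_Nil list.sel(3))
  qed
qed

locale frog_scales = scales +
  fixes p :: "vertex \<Rightarrow> nat pmf"
  assumes H_pos: "1 \<le> H"
    and mean: "\<And>v. v \<in> nonroot_verts d n \<Longrightarrow>
      integrable (measure_pmf (p v)) real \<and> measure_pmf.expectation (p v) real \<le> \<mu>"
begin

abbreviation "M \<equiv> frog_model d n p"

lemma d_n_pos: "d \<ge> 1" "n \<ge> 1" using d2 H1 by auto

definition targets :: "vertex set" where "targets = {v \<in> tree_verts d n. length v = top_depth - 1}"

lemma finite_targets: "finite targets"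
  unfolding targets_def using finite_tree_verts by auto

text \<open>For each scale from \<open>h\<close> on, the chain leaves the current subtree of that scale in less than \<open>2 ^ h'\<close>
  moves, and in less than \<open>2 ^ (h' - 1)\<close> if the jump has been used. In the second case, no long excursion of scale
  \<open>h' - 1\<close> fits in.\<close>

definition deadlines :: "nat \<Rightarrow> (nat \<Rightarrow> bool) \<Rightarrow> vertex \<Rightarrow> move list \<Rightarrow> bool" where
  "deadlines h b y ms \<longleftrightarrow>
     (\<forall>h'\<in>{h..H}. \<exists>t < 2 ^ (if b h' then h' else h' - 1). exits (n - h' * j) t y ms)"

text \<open>The chain, at present carried by frog \<open>f\<close> at vertex \<open>y\<close> and at the own time \<open>k\<close> of \<open>f\<close>, can be
  continued to \<open>v\<close> in less than \<open>N\<close> moves, within the deadlines and without a hand-over at a vertex of \<open>U\<close>. This keeps its frogs independent of the history.\<close>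

definition completable where
  "completable h b N U y f k v = {\<omega>. \<exists>ms. length ms < N \<and> route d n y ms \<and> distinct (switches ms) \<and>
     set (switches ms) \<inter> U = {} \<and> end_vertex y ms = v \<and> deadlines h b y ms \<and>
     follows (fst \<omega>) (snd \<omega>) f k ms}"

lemma completableI:
  assumes "length ms < N" "route d n y ms" "distinct (switches ms)" "set (switches ms) \<inter> U = {}"
    "end_vertex y ms = v" "deadlines h b y ms" "follows (fst \<omega>) (snd \<omega>) f k ms"
  shows "\<omega> \<in> completable h b N U y f k v"
  unfolding completable_def using assms by blast

text \<open>The history \<open>A\<close> on \<open>U\<close> restricts the walk of the current carrier, whose home is \<open>u\<close>, only up to its
  time \<open>k\<close>, when it is at \<open>y\<close>. So its next step is still free.\<close>

definition consistent :: "vertex set \<Rightarrow> (vertex \<Rightarrow> (nat \<Rightarrow> vertex) set) \<Rightarrow> vertex \<Rightarrow> nat \<Rightarrow> vertex \<Rightarrow> bool" where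
  "consistent U A u k y \<longleftrightarrow> finite U \<and> U \<subseteq> tree_verts d n \<and> [] \<in> U \<and> u \<in> U \<and>
     (\<forall>x\<in>U. A x \<in> sets path_space) \<and> prefix_event k (A u) \<and> A u \<subseteq> {X. X k = y} \<and> y \<in> tree_verts d n"

definition realized where
  "realized h b N U \<iota> A u k y v = history U \<iota> A \<inter> completable h b N U y (u, \<iota> u) k v"

text \<open>An expected number of targets, if \<open>S v\<close> is the event that \<open>v\<close> is reached.\<close>

definition mass where "mass S = (\<Sum>v\<in>targets. emeasure M (S v \<inter> space M))"

definition family_measurable where "family_measurable S \<longleftrightarrow> (\<forall>v. S v \<inter> space M \<in> sets M)"

lemma completable_measurable: "completable h b N U y f k v \<inter> space M \<in> sets M"
proof -
  note follows_measurable[measurable]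
  have "Measurable.pred M (\<lambda>\<omega>. \<exists>ms. (length ms < N \<and> route d n y ms \<and> distinct (switches ms) \<and>
     set (switches ms) \<inter> U = {} \<and> end_vertex y ms = v \<and> deadlines h b y ms) \<and>
     follows (fst \<omega>) (snd \<omega>) f k ms)"
    by measurable
  then show ?thesis unfolding completable_def pred_def by (simp add: Int_def conj_commute conj_assoc conj_left_commute)
qed

lemma realized_measurable: "consistent U A u k y \<Longrightarrow> family_measurable (realized h b N U \<iota> A u k y)"
  unfolding family_measurable_def
proof
  fix v assume "consistent U A u k y"
  then have "history U \<iota> A \<inter> space M \<in> sets M"
    by (intro history_measurable) (auto simp: consistent_def)
  then have "(history U \<iota> A \<inter> space M) \<inter> (completable h b N U y (u, \<iota> u) k v \<inter> space M) \<in> sets M"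
    using completable_measurable by (rule sets.Int)
  then show "realized h b N U \<iota> A u k y v \<inter> space M \<in> sets M"
    unfolding realized_def by (simp add: Int_ac)
qed

lemma family_measurable_empty: "family_measurable (\<lambda>v. {})" by (simp add: family_measurable_def)

lemma mass_mono: "(\<And>v. v \<in> targets \<Longrightarrow> S v \<subseteq> T v) \<Longrightarrow> family_measurable T \<Longrightarrow> mass S \<le> mass T"
  unfolding mass_def family_measurable_def by (intro sum_mono emeasure_mono) blast+

lemma family_measurable_Un: "family_measurable S \<Longrightarrow> family_measurable T \<Longrightarrow> family_measurable (\<lambda>v. S v \<union> T v)"
  unfolding family_measurable_def by (simp add: Int_Un_distrib2)

lemma mass_Un: "family_measurable S \<Longrightarrow> family_measurable T \<Longrightarrow> mass (\<lambda>v. S v \<union> T v) \<le> mass S + mass T"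
  unfolding mass_def family_measurable_def sum.distrib[symmetric] Int_Un_distrib2
  by (intro sum_mono emeasure_subadditive) auto

lemma family_measurable_UN:
  assumes "\<And>i. i \<in> I \<Longrightarrow> family_measurable (S i)" "countable I"
  shows "family_measurable (\<lambda>v. \<Union>i\<in>I. S i v)"
  unfolding family_measurable_def
proof
  fix v
  have "(\<Union>i\<in>I. S i v \<inter> space M) \<in> sets M"
    using assms by (intro sets.countable_UN') (auto simp: family_measurable_def)
  then show "(\<Union>i\<in>I. S i v) \<inter> space M \<in> sets M" by simp
qed

lemma mass_UN_finite:
  assumes "finite I" "\<And>i. i \<in> I \<Longrightarrow> family_measurable (S i)"
  shows "mass (\<lambda>v. \<Union>i\<in>I. S i v) \<le> (\<Sum>i\<in>I. mass (S i))"
proof -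
  have "mass (\<lambda>v. \<Union>i\<in>I. S i v) \<le> (\<Sum>v\<in>targets. \<Sum>i\<in>I. emeasure M (S i v \<inter> space M))"
    unfolding mass_def
  proof (rule sum_mono)
    fix v
    have "emeasure M (\<Union>i\<in>I. S i v \<inter> space M) \<le> (\<Sum>i\<in>I. emeasure M (S i v \<inter> space M))"
      by (rule emeasure_subadditive_finite) (use assms in \<open>auto simp: family_measurable_def\<close>)
    then show "emeasure M ((\<Union>i\<in>I. S i v) \<inter> space M) \<le> (\<Sum>i\<in>I. emeasure M (S i v \<inter> space M))"
      by (simp add: Int_UN_distrib2)
  qed
  also have "\<dots> = (\<Sum>i\<in>I. mass (S i))" unfolding mass_def by (rule sum.swap)
  finally show ?thesis .
qed

lemma mass_UN_nat:
  assumes "\<And>i. family_measurable (S i)"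
  shows "mass (\<lambda>v. \<Union>i::nat. S i v) \<le> (\<Sum>i. mass (S i))"
proof -
  have "mass (\<lambda>v. \<Union>i. S i v) \<le> (\<Sum>v\<in>targets. \<Sum>i. emeasure M (S i v \<inter> space M))"
    unfolding mass_def
  proof (rule sum_mono)
    fix v
    have "emeasure M (\<Union>i. S i v \<inter> space M) \<le> (\<Sum>i. emeasure M (S i v \<inter> space M))"
      by (rule emeasure_subadditive_countably) (use assms in \<open>auto simp: family_measurable_def\<close>)
    then show "emeasure M ((\<Union>i. S i v) \<inter> space M) \<le> (\<Sum>i. emeasure M (S i v \<inter> space M))"
      by (simp add: Int_UN_distrib2)
  qed
  also have "\<dots> = (\<Sum>i. mass (S i))" unfolding mass_def
    by (rule suminf_sum[symmetric]) auto
  finally show ?thesis .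
qed

definition lowest_level :: "nat \<Rightarrow> nat" where "lowest_level h = (if h \<le> H then n - h * j else 0)"

text \<open>The statement that is proved by induction on \<open>N\<close>. The lower end of zone \<open>h\<close> belongs to it as well
  as to zone \<open>h - 1\<close>; a chain there still has to decide between a short and a long excursion.\<close>

definition potential_bounds :: "nat \<Rightarrow> nat \<Rightarrow> bool" where
  "potential_bounds N h \<longleftrightarrow> (\<forall>b U \<iota> A u k y. consistent U A u k y \<longrightarrow> lowest_level h \<le> length y \<longrightarrow> length y \<le> n - (h - 1) * j \<longrightarrow>
     mass (realized h b N U \<iota> A u k y) \<le> history_prob d n p U \<iota> A * ennreal (pot h b (length y)))"

lemma consistent_step:
  assumes "consistent U A u k y" "z \<in> nbrs d n y"
  shows "consistent U (A(u := A u \<inter> {X. X (Suc k) = z})) u (Suc k) z"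
    and "z \<notin> U \<Longrightarrow> consistent (insert z U) ((A(u := A u \<inter> {X. X (Suc k) = z}))(z := {X. X 0 = z})) z 0 z"
proof -
  have pe: "prefix_event (Suc k) (A u \<inter> {X. X (Suc k) = z})"
    using assms(1) by (intro prefix_event_Int prefix_event_at prefix_event_mono[of k _ "Suc k"]) (auto simp: consistent_def)
  have ms: "A u \<inter> {X. X (Suc k) = z} \<in> sets path_space" by (rule prefix_event_measurable[OF pe])
  have zt: "z \<in> tree_verts d n" using assms(2) by (simp add: nbrs_def)
  have p0: "{X. X 0 = z} \<in> sets path_space" by (rule prefix_event_measurable[OF prefix_event_at])
  show "consistent U (A(u := A u \<inter> {X. X (Suc k) = z})) u (Suc k) z"
    using assms(1) pe ms zt unfolding consistent_def by auto
  show "consistent (insert z U) ((A(u := A u \<inter> {X. X (Suc k) = z}))(z := {X. X 0 = z})) z 0 z" if "z \<notin> U"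
    using assms(1) ms zt p0 prefix_event_at[of 0 z] that unfolding consistent_def by auto
qed

lemma suminf_count_le:
  assumes "z \<in> nonroot_verts d n" shows "(\<Sum>i. frog_exists_prob p z i) \<le> ennreal \<mu>"
  using suminf_frog_exists_prob_le[of z p \<mu>] mean[OF assms] assms by (auto simp: nonroot_verts_def)

text \<open>A step up from the top vertex of a zone leaves the subtree, and its deadline with it. All other
  exits lie at least one move after the step.\<close>

lemma deadlines_step:
  assumes "deadlines h b y ((z, m) # ms)" "z \<in> nbrs d n y" "lowest_level h \<le> length y" "1 \<le> h"
  shows "deadlines (if length z > length y then h else up_scale h (length y)) b z ms"
  unfolding deadlines_def
proof
  let ?h = "if length z > length y then h else up_scale h (length y)"
  fix h' assume h': "h' \<in> {?h..H}"
  then have "h \<le> h'" by (auto simp: up_scale_def split: if_splits)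
  then obtain t where t: "t < 2 ^ (if b h' then h' else h' - 1)" "exits (n - h' * j) t y ((z, m) # ms)"
    using assms(1) h' unfolding deadlines_def by (meson atLeastAtMost_iff)
  have "n - h' * j \<le> length z"
  proof (cases "length z > length y")
    case True
    have "n - h' * j \<le> n - h * j" using \<open>h \<le> h'\<close> by (intro diff_le_mono2 mult_le_mono1)
    then show ?thesis using True assms(3) h' \<open>h \<le> h'\<close> by (auto simp: lowest_level_def)
  next
    case False
    then have lz: "Suc (length z) = length y" using assms(2) by (auto simp: nbrs_def)
    show ?thesis
    proof (cases "length y = n - h * j")
      case True
      then have "Suc h \<le> h'" using h' False \<open>h \<le> h'\<close> by (auto simp: up_scale_def)
      then have "Suc h * j \<le> h' * j" by (intro mult_le_mono1)
      then have "h * j + j \<le> h' * j" by simp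
      then show ?thesis using True lz j2 by linarith
    next
      case F: False
      have "n - h' * j \<le> n - h * j" using \<open>h \<le> h'\<close> by (intro diff_le_mono2 mult_le_mono1)
      then show ?thesis using F lz assms(3) h' \<open>h \<le> h'\<close> by (auto simp: lowest_level_def)
    qed
  qed
  then have "t \<noteq> 1" using t(2) by (auto simp: exits_def)
  then have "1 < t" using t(2) by (auto simp: exits_def)
  then have "exits (n - h' * j) (t - 1) z ms" using t(2) exits_Cons by blast
  then show "\<exists>t < 2 ^ (if b h' then h' else h' - 1). exits (n - h' * j) t z ms"
    using t(1) by (intro exI[of _ "t - 1"]) auto
qed

lemma nbr_level:
  assumes "z \<in> nbrs d n y" "lowest_level h \<le> length y" "length y < n - (h - 1) * j"
  defines "h' \<equiv> if length z > length y then h else up_scale h (length y)"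
  shows "lowest_level h' \<le> length z \<and> length z \<le> n - (h' - 1) * j"
proof (cases "length z > length y")
  case True
  moreover have "length z = Suc (length y)" using assms(1) True by (auto simp: nbrs_def)
  ultimately show ?thesis using assms by simp
next
  case False
  then have lz: "Suc (length z) = length y" using assms(1) by (auto simp: nbrs_def)
  show ?thesis
  proof (cases "h \<le> H \<and> length y = n - h * j")
    case True
    have "lowest_level (Suc h) \<le> length z"
    proof (cases "Suc h \<le> H")
      case T: True
      define a where "a = n - Suc h * j"
      have "n - h * j = a + j" using level_arith(1)[of "Suc h"] T unfolding a_def by simp
      then have "length y = a + j" using True by simp
      moreover have "lowest_level (Suc h) = a" using T by (simp add: lowest_level_def a_def)
      ultimately show ?thesis using lz j2 by simp
    qed (simp add: lowest_level_def)
    moreover have "length z \<le> n - h * j" using conjunct2[OF True] lz by simp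
    ultimately show ?thesis using True False by (simp add: h'_def up_scale_def)
  next
    case F: False
    then have "lowest_level h \<le> length z" using lz assms(2) by (auto simp: lowest_level_def)
    moreover have "up_scale h (length y) = h" using F by (auto simp: up_scale_def)
    ultimately show ?thesis using False lz assms(3) by (simp add: h'_def)
  qed
qed

text \<open>First-step analysis. Either the chain is at its target, or the carrier makes a step, and after
  a step down the chain may be handed over to a new frog at the vertex reached. The index of
  this frog is summed over, which turns the probabilities that it exists into the mean \<open>\<mu>\<close>.\<close>

lemma realized_step:
  assumes st: "consistent U A u k y" and lev: "lowest_level h \<le> length y" and h: "1 \<le> h" "h \<le> Suc H"
    and IH: "potential_bounds N h" "potential_bounds N (up_scale h (length y))" and lt: "length y < n - (h - 1) * j"
  shows "mass (realized h b (Suc N) U \<iota> A u k y) \<le> history_prob d n p U \<iota> A *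
    ennreal ((if length y = top_depth - 1 \<and> h = Suc H then 1 else 0) +
      (\<Sum>z\<in>nbrs d n y. (if length z > length y then (1 + \<mu>) * pot h b (length z)
         else pot (up_scale h (length y)) b (length z)) / real (card (nbrs d n y))))"
proof -
  let ?pr = "history_prob d n p U \<iota> A"
  let ?deg = "real (card (nbrs d n y))"
  let ?f = "\<lambda>z. (if length z > length y then (1 + \<mu>) * pot h b (length z)
         else pot (up_scale h (length y)) b (length z)) / ?deg"
  let ?hs = "\<lambda>z. if length z > length y then h else up_scale h (length y)"
  let ?A = "\<lambda>z. A(u := A u \<inter> {X. X (Suc k) = z})"
  (* T0: arrived; T1: the same frog moves on; T2: frog i at z takes over. *)
  define T0 where "T0 v = (if v = y \<and> h = Suc H then history U \<iota> A else {})" for v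
  define T1 where "T1 z = realized (?hs z) b N U \<iota> (?A z) u (Suc k) z" for z
  define T2 where "T2 z i = (if length z > length y \<and> z \<notin> U
      then realized h b N (insert z U) (\<iota>(z := i)) ((?A z)(z := {X. X 0 = z})) z 0 z else (\<lambda>v. {}))" for z i
  have y: "y \<in> tree_verts d n" and U: "finite U" "u \<in> U" "[] \<in> U" "U \<subseteq> tree_verts d n"
    using st by (auto simp: consistent_def)
  have fin: "finite (nbrs d n y)" by (rule finite_nbrs)
  have m0: "family_measurable T0"
    unfolding family_measurable_def T0_def using st by (auto intro!: history_measurable simp: consistent_def)
  have m1: "family_measurable (T1 z)" if "z \<in> nbrs d n y" for z
    unfolding T1_def by (rule realized_measurable[OF consistent_step(1)[OF st that]])
  have m2: "family_measurable (T2 z i)" if "z \<in> nbrs d n y" for z i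
    unfolding T2_def using realized_measurable[OF consistent_step(2)[OF st that]] family_measurable_empty by auto
  have sub: "realized h b (Suc N) U \<iota> A u k y v \<subseteq> T0 v \<union> (\<Union>z\<in>nbrs d n y. T1 z v \<union> (\<Union>i. T2 z i v))" for v
  proof
    fix \<omega> assume "\<omega> \<in> realized h b (Suc N) U \<iota> A u k y v"
    then obtain ms where hi: "\<omega> \<in> history U \<iota> A" and ms: "length ms < Suc N" "route d n y ms" "distinct (switches ms)"
        "set (switches ms) \<inter> U = {}" "end_vertex y ms = v" "deadlines h b y ms"
        "follows (fst \<omega>) (snd \<omega>) (u, \<iota> u) k ms"
      unfolding realized_def completable_def by blast
    show "\<omega> \<in> T0 v \<union> (\<Union>z\<in>nbrs d n y. T1 z v \<union> (\<Union>i. T2 z i v))"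
    proof (cases ms)
      case Nil
      then have "h = Suc H" using ms(6) h by (auto simp: deadlines_def exits_def)
      then show ?thesis using hi ms(5) Nil by (auto simp: T0_def)
    next
      case (Cons m ms')
      obtain z o' where m: "m = (z, o')" by (cases m)
      have z: "z \<in> nbrs d n y" "route d n z ms'" "end_vertex z ms' = v" "length ms' < N"
        using ms Cons m by auto
      have dl: "deadlines (?hs z) b z ms'"
        using deadlines_step[of h b y z o' ms'] ms(6) Cons m z(1) lev h(1) by simp
      show ?thesis
      proof (cases o')
        case None
        have X: "snd \<omega> (u, \<iota> u) (Suc k) = z" "follows (fst \<omega>) (snd \<omega>) (u, \<iota> u) (Suc k) ms'"
          using ms(7) Cons m None by auto
        have "\<omega> \<in> history U \<iota> (?A z)" using hi X(1) by (auto simp: history_def)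
        moreover have "\<omega> \<in> completable (?hs z) b N U z (u, \<iota> u) (Suc k) v"
          using completableI[OF z(4,2) _ _ z(3) dl X(2)] ms(3,4) Cons m None by simp
        ultimately have "\<omega> \<in> T1 z v" unfolding T1_def realized_def by simp
        then show ?thesis using z(1) by blast
      next
        case (Some i)
        have down: "length y < length z" using ms(2) Cons m Some by simp
        have X: "snd \<omega> (u, \<iota> u) (Suc k) = z" "i < frogs_at (fst \<omega>) z" "snd \<omega> (z, i) 0 = z"
            "follows (fst \<omega>) (snd \<omega>) (z, i) 0 ms'"
          using ms(7) Cons m Some by auto
        have zU: "z \<notin> U" "set (switches ms') \<inter> insert z U = {}" "distinct (switches ms')"
          using ms(3,4) Cons m Some by auto
        have "\<omega> \<in> history (insert z U) (\<iota>(z := i)) ((?A z)(z := {X. X 0 = z}))"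
          using hi X zU(1) U(2) by (auto simp: history_def)
        moreover have "\<omega> \<in> completable h b N (insert z U) z (z, (\<iota>(z := i)) z) 0 v"
          using completableI[OF z(4,2) zU(3,2) z(3)] dl X(4) down by simp
        ultimately have "\<omega> \<in> T2 z i v" unfolding T2_def realized_def using down zU(1) by simp
        then show ?thesis using z(1) by blast
      qed
    qed
  qed
  have m3: "family_measurable (\<lambda>v. T1 z v \<union> (\<Union>i. T2 z i v))" if "z \<in> nbrs d n y" for z
    using m1 m2 that by (intro family_measurable_Un family_measurable_UN) auto
  have m4: "family_measurable (\<lambda>v. \<Union>z\<in>nbrs d n y. T1 z v \<union> (\<Union>i. T2 z i v))"
    using m3 countable_finite[OF fin] by (rule family_measurable_UN)
  have "mass (realized h b (Suc N) U \<iota> A u k y) \<le> mass (\<lambda>v. T0 v \<union> (\<Union>z\<in>nbrs d n y. T1 z v \<union> (\<Union>i. T2 z i v)))"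
    using sub m0 m4 by (intro mass_mono family_measurable_Un)
  also have "\<dots> \<le> mass T0 + mass (\<lambda>v. \<Union>z\<in>nbrs d n y. T1 z v \<union> (\<Union>i. T2 z i v))"
    using m0 m4 by (rule mass_Un)
  also have "\<dots> \<le> mass T0 + (\<Sum>z\<in>nbrs d n y. mass (T1 z) + (\<Sum>i. mass (T2 z i)))"
  proof (intro add_left_mono order.trans[OF mass_UN_finite[OF fin]] sum_mono)
    fix z assume z: "z \<in> nbrs d n y"
    show "family_measurable (\<lambda>v. T1 z v \<union> (\<Union>i. T2 z i v))" using m3 z .
    have "mass (\<lambda>v. T1 z v \<union> (\<Union>i. T2 z i v)) \<le> mass (T1 z) + mass (\<lambda>v. \<Union>i. T2 z i v)"
      using m1 m2 z by (intro mass_Un family_measurable_UN) auto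
    also have "\<dots> \<le> mass (T1 z) + (\<Sum>i. mass (T2 z i))"
      using m2 z by (intro add_left_mono mass_UN_nat) auto
    finally show "mass (\<lambda>v. T1 z v \<union> (\<Union>i. T2 z i v)) \<le> mass (T1 z) + (\<Sum>i. mass (T2 z i))" .
  qed
  also have "\<dots> \<le> ?pr * ennreal (if length y = top_depth - 1 \<and> h = Suc H then 1 else 0) +
      (\<Sum>z\<in>nbrs d n y. ?pr * ennreal ((if length z > length y then (1 + \<mu>) * pot h b (length z)
         else pot (up_scale h (length y)) b (length z)) / ?deg))"
  proof (intro add_mono sum_mono)
    have e: "emeasure M (history U \<iota> A \<inter> space M) = ?pr"
      using st by (intro emeasure_history) (auto simp: consistent_def)
    have "mass T0 = (\<Sum>v\<in>targets. if v = y then (if h = Suc H then ?pr else 0) else 0)"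
      unfolding mass_def T0_def by (intro sum.cong) (auto simp: e)
    also have "\<dots> \<le> ?pr * ennreal (if length y = top_depth - 1 \<and> h = Suc H then 1 else 0)"
      using finite_targets by (auto simp: targets_def)
    finally show "mass T0 \<le> ?pr * ennreal (if length y = top_depth - 1 \<and> h = Suc H then 1 else 0)" .
  next
    fix z assume z: "z \<in> nbrs d n y"
    have stz: "consistent U (?A z) u (Suc k) z" by (rule consistent_step(1)[OF st z])
    have zlen: "length z = Suc (length y) \<or> Suc (length z) = length y" using z by (auto simp: nbrs_def)
    have zlev: "lowest_level (?hs z) \<le> length z" "length z \<le> n - (?hs z - 1) * j"
      using nbr_level[OF z lev lt] by blast+
    have bd: "potential_bounds N (?hs z)" using IH by simp
    have pz: "history_prob d n p U \<iota> (?A z) \<le> ?pr * ennreal (1 / ?deg)"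
      using st by (intro history_prob_update srw_Markov[OF _ d_n_pos]) (auto simp: consistent_def)
    have t1: "mass (T1 z) \<le> ?pr * ennreal (pot (?hs z) b (length z) / ?deg)"
    proof -
      have "mass (T1 z) \<le> history_prob d n p U \<iota> (?A z) * ennreal (pot (?hs z) b (length z))"
        unfolding T1_def using bd stz zlev unfolding potential_bounds_def by blast
      also have "\<dots> \<le> ?pr * ennreal (1 / ?deg) * ennreal (pot (?hs z) b (length z))"
        by (rule mult_right_mono[OF pz]) simp
      also have "\<dots> = ?pr * ennreal (pot (?hs z) b (length z) / ?deg)"
        by (simp add: mult.assoc pot_nonneg flip: ennreal_mult)
      finally show ?thesis .
    qed
    show "mass (T1 z) + (\<Sum>i. mass (T2 z i)) \<le> ?pr * ennreal ((if length z > length y then (1 + \<mu>) * pot h b (length z)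
         else pot (up_scale h (length y)) b (length z)) / ?deg)"
    proof (cases "length z > length y \<and> z \<notin> U")
      case False
      then have "(\<Sum>i. mass (T2 z i)) = 0" by (auto simp: T2_def mass_def)
      then have "mass (T1 z) + (\<Sum>i. mass (T2 z i)) \<le> ?pr * ennreal (pot (?hs z) b (length z) / ?deg)"
        using t1 by simp
      also have "\<dots> \<le> ?pr * ennreal ((if length z > length y then (1 + \<mu>) * pot h b (length z)
         else pot (up_scale h (length y)) b (length z)) / ?deg)"
        using mu0 pot_nonneg[of h b "length z"]
        by (intro mult_left_mono ennreal_leI divide_right_mono) (auto simp: distrib_right)
      finally show ?thesis .
    next
      case True
      let ?w = "pot h b (length z)"
      have zn: "z \<in> nonroot_verts d n" using True z by (auto simp: nbrs_def nonroot_verts_def)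
      have t2: "mass (T2 z i) \<le> ?pr * ennreal (1 / ?deg) * ennreal ?w * frog_exists_prob p z i" for i
      proof -
        have "mass (T2 z i) \<le> history_prob d n p (insert z U) (\<iota>(z := i)) ((?A z)(z := {X. X 0 = z})) * ennreal ?w"
          using True consistent_step(2)[OF st z] zlev IH(1) unfolding T2_def potential_bounds_def by simp
        also have "history_prob d n p (insert z U) (\<iota>(z := i)) ((?A z)(z := {X. X 0 = z})) \<le>
            ?pr * ennreal (1 / ?deg) * (frog_exists_prob p z i * 1)"
        proof -
          interpret prob_space "srw d n z" by (rule prob_space_srw)
          show ?thesis
            using True U(1) by (subst history_prob_insert) (auto intro!: mult_mono[OF pz] mult_left_mono emeasure_le_1 simp del: mult_1_right)
        qed
        finally show ?thesis by (simp add: mult_ac mult_right_mono)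
      qed
      have "(\<Sum>i. mass (T2 z i)) \<le> (\<Sum>i. ?pr * ennreal (1 / ?deg) * ennreal ?w * frog_exists_prob p z i)"
        by (intro suminf_le t2) auto
      also have "\<dots> = ?pr * ennreal (1 / ?deg) * ennreal ?w * (\<Sum>i. frog_exists_prob p z i)"
        by simp
      also have "\<dots> \<le> ?pr * ennreal (1 / ?deg) * ennreal ?w * ennreal \<mu>"
        by (intro mult_left_mono suminf_count_le[OF zn]) simp
      also have "\<dots> = ?pr * ennreal (\<mu> * ?w / ?deg)"
        using mu0 by (simp add: mult.assoc pot_nonneg mult.commute[of \<mu>] flip: ennreal_mult)
      finally have "mass (T1 z) + (\<Sum>i. mass (T2 z i)) \<le> ?pr * ennreal (?w / ?deg) + ?pr * ennreal (\<mu> * ?w / ?deg)"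
        using t1 True by (intro add_mono) auto
      also have "\<dots> = ?pr * ennreal ((1 + \<mu>) * ?w / ?deg)"
        using mu0 pot_nonneg[of h b "length z"]
        by (simp add: add_divide_distrib distrib_right flip: distrib_left ennreal_plus)
      finally show ?thesis using True by simp
    qed
  qed
  also have "\<dots> = ?pr * ennreal ((if length y = top_depth - 1 \<and> h = Suc H then 1 else 0) + (\<Sum>z\<in>nbrs d n y. ?f z))"
  proof -
    have nn: "?f z \<ge> 0" for z using mu0 pot_nonneg by simp
    show ?thesis
      by (simp only: ennreal_plus[OF _ sum_nonneg[OF nn]] sum_ennreal[OF nn, symmetric] distrib_left sum_distrib_left
          zero_le_one order_refl if_True if_False simp_thms split: if_split)
  qed
  finally show ?thesis .
qed


section \<open>Long excursions and summation over chains\<close>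

lemma interior_sum:
  assumes "y \<in> tree_verts d n" "y \<noteq> []" "length y < n"
  shows "(\<Sum>z\<in>nbrs d n y. (if length z > length y then (1 + \<mu>) * g (length z) else f (length z)) / real (card (nbrs d n y)))
    = (f (length y - 1) + real d * (1 + \<mu>) * g (Suc (length y))) / (real d + 1)"
proof -
  have ni: "tl y \<notin> (\<lambda>i. i # y) ` {..<d}" by (auto dest!: arg_cong[of _ _ length])
  have "(\<Sum>z\<in>nbrs d n y. (if length z > length y then (1 + \<mu>) * g (length z) else f (length z)) / (real d + 1)) =
      f (length y - 1) / (real d + 1) + (\<Sum>i<d. (1 + \<mu>) * g (Suc (length y)) / (real d + 1))"
    unfolding nbrs_interior(1)[OF assms] using ni
    by (subst sum.insert) (auto simp: sum.reindex inj_on_def)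
  also have "\<dots> = (f (length y - 1) + real d * (1 + \<mu>) * g (Suc (length y))) / (real d + 1)"
    by (simp add: add_divide_distrib)
  finally show ?thesis using nbrs_interior(2)[OF assms] by (simp add: add.commute)
qed

lemma root_sum:
  "(\<Sum>z\<in>nbrs d n []. (if length z > length ([] :: vertex) then (1 + \<mu>) * g (length z) else f (length z)) / real (card (nbrs d n [])))
    = (1 + \<mu>) * g 1"
  unfolding nbrs_root(2)[OF d_n_pos(2)] unfolding nbrs_root(1)[OF d_n_pos(2)] using d_pos
  by (subst sum.reindex) (auto simp: inj_on_def)

lemma interior_bound:
  assumes st: "consistent U A u k y" and lev: "lowest_level h \<le> length y" and h: "1 \<le> h" "h \<le> Suc H"
    and IH: "\<And>h'. 1 \<le> h' \<Longrightarrow> h' \<le> Suc H \<Longrightarrow> potential_bounds N h'" and lt: "length y < n - (h - 1) * j"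
  shows "mass (realized h b (Suc N) U \<iota> A u k y) \<le> history_prob d n p U \<iota> A * ennreal (pot h b (length y))"
proof -
  have y: "y \<in> tree_verts d n" using st by (simp add: consistent_def)
  have up: "1 \<le> up_scale h (length y)" "up_scale h (length y) \<le> Suc H"
    using h by (auto simp: up_scale_def)
  have "(if length y = top_depth - 1 \<and> h = Suc H then 1 else 0) +
      (\<Sum>z\<in>nbrs d n y. (if length z > length y then (1 + \<mu>) * pot h b (length z)
         else pot (up_scale h (length y)) b (length z)) / real (card (nbrs d n y))) \<le> pot h b (length y)"
  proof (cases "y = []")
    case True
    have "h = Suc H"
    proof (rule ccontr)
      assume "h \<noteq> Suc H"
      then have "h \<le> H" using h by simp
      then show False using level_arith(3)[of h] lev True h by (simp add: lowest_level_def)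
    qed
    then show ?thesis unfolding True root_sum using pot_root top_depth_ge by simp
  next
    case False
    have "length y < n" using lt by simp
    note s = interior_sum[OF y False this]
    have l1: "1 \<le> length y" using False by (cases y) auto
    show ?thesis
    proof (cases "h = Suc H")
      case True
      then show ?thesis unfolding s using pot_top_interior[OF l1, of b] by simp
    next
      case False
      then have "h \<le> H" using h by simp
      then show ?thesis unfolding s using pot_interior[of h "length y" b] False lev h by (simp add: lowest_level_def)
    qed
  qed
  then show ?thesis
    by (intro order.trans[OF realized_step[OF st lev h IH[OF h] IH[OF up] lt]] mult_left_mono ennreal_leI) auto
qed

lemma consistent_jump:
  assumes "consistent U A u k y" "z \<in> tree_verts d n"
  shows "consistent U (A(u := A u \<inter> {X. X (k + t) = z})) u (k + t) z"
    and "x \<in> tree_verts d n \<Longrightarrow> x \<notin> U \<Longrightarrow> consistent (insert x U) (A(x := {X. X l = z})) x l z"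
proof -
  have pe: "prefix_event (k + t) (A u \<inter> {X. X (k + t) = z})"
    using assms(1) by (intro prefix_event_Int prefix_event_at prefix_event_mono[of k _ "k + t"]) (auto simp: consistent_def)
  then show "consistent U (A(u := A u \<inter> {X. X (k + t) = z})) u (k + t) z"
    using assms prefix_event_measurable[OF pe] unfolding consistent_def by auto
  show "consistent (insert x U) (A(x := {X. X l = z})) x l z" if "x \<in> tree_verts d n" "x \<notin> U"
    using assms that prefix_event_at[of l z] prefix_event_measurable[OF prefix_event_at[of l z]] unfolding consistent_def by auto
qed

text \<open>The first exit time \<open>s\<close> of a long excursion is at least \<open>2 ^ (h - 1)\<close>. So the jump was
  available, and of the time below \<open>2 ^ h\<close> for scale \<open>h\<close> less than \<open>2 ^ (h - 1)\<close> is left afterwards.\<close>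

lemma long_excursion:
  assumes ms: "route d n y ms" "deadlines h b y ms" and h: "1 \<le> h" "h \<le> H" and y: "length y = n - (h - 1) * j"
    and long: "\<not> (\<exists>t<2 ^ (h - 1). exits (length y) t y ms)"
  obtains s where "1 \<le> s" "s \<le> length ms" "s < 2 ^ H" "b h" "end_vertex y (take s ms) = tl y"
    "deadlines h (b(h := False)) (tl y) (drop s ms)"
proof -
  have lev: "length y = n - h * j + j" using level_arith(1)[OF h] y by simp
  have low: "n - h' * j + j \<le> length y" if "h \<le> h'" for h'
    using lev diff_le_mono2[OF mult_le_mono1[OF that, of j], of n] by simp
  have ex: "\<exists>t < 2 ^ (if b h' then h' else h' - 1). exits (n - h' * j) t y ms" if "h \<le> h'" "h' \<le> H" for h'
    using ms(2) that unfolding deadlines_def by auto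
  have exy: "exits (length y) t y ms" if "exits (n - h' * j) t y ms" "h \<le> h'" for t h'
    using that low[OF that(2)] by (auto simp: exits_def)
  define s where "s = (LEAST t. exits (length y) t y ms)"
  obtain th where th: "th < 2 ^ (if b h then h else h - 1)" "exits (n - h * j) th y ms" using ex[of h] h by auto
  have s: "exits (length y) s y ms" unfolding s_def using exy[OF th(2)] by (rule LeastI) simp
  have least: "s \<le> t" if "exits (length y) t y ms" for t unfolding s_def using that by (rule Least_le)
  have s_ge: "2 ^ (h - 1) \<le> s" using long s by (meson not_le)
  have sl: "1 \<le> s" "s \<le> length ms" using s by (auto simp: exits_def)
  have "s \<le> th" using least exy[OF th(2)] by simp
  have bh: "b h" using s_ge \<open>s \<le> th\<close> th(1) by (auto split: if_splits)
  have "(2::nat) ^ h \<le> 2 ^ H" using h by simp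
  moreover have "th < 2 ^ h" using th(1) bh by simp
  ultimately have sH: "s < 2 ^ H" using \<open>s \<le> th\<close> by linarith
  have ev: "end_vertex y (take s ms) = tl y"
  proof (rule first_exit_to_parent[OF ms(1) sl(2)])
    show "length (end_vertex y (take s ms)) < length y" using s by (simp add: exits_def)
    show "\<not> length (end_vertex y (take t ms)) < length y" if "t < s" for t
      using least[of t] that sl by (cases t) (auto simp: exits_def)
  qed
  have "deadlines h (b(h := False)) (tl y) (drop s ms)"
    unfolding deadlines_def
  proof
    fix h' assume "h' \<in> {h..H}"
    then have h': "h \<le> h'" "h' \<le> H" by auto
    obtain t where t: "t < 2 ^ (if b h' then h' else h' - 1)" "exits (n - h' * j) t y ms" using ex[OF h'] by auto
    have "s \<le> t" using least exy[OF t(2) h'(1)] by simp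
    moreover have "s \<noteq> t"
    proof
      assume "s = t"
      then have "length (tl y) < n - h' * j" using t(2) ev by (simp add: exits_def)
      then show False using low[OF h'(1)] j2 by simp
    qed
    ultimately have st: "s < t" by simp
    have "exits (n - h' * j) (t - s) (tl y) (drop s ms)" using exits_drop[OF st t(2)] ev by simp
    moreover have "t - s < 2 ^ (if (b(h := False)) h' then h' else h' - 1)"
    proof (cases "h' = h")
      case True
      have "(2::nat) ^ h = 2 ^ (h - 1) + 2 ^ (h - 1)" using h by (cases h) auto
      then show ?thesis using True t(1) bh s_ge by simp
    next
      case False
      then show ?thesis using t(1) by simp
    qed
    ultimately show "\<exists>t < 2 ^ (if (b(h := False)) h' then h' else h' - 1). exits (n - h' * j) t (tl y) (drop s ms)"
      by blast
  qed
  then show ?thesis using that sl sH bh ev by blast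
qed

text \<open>After a long excursion the chain is at \<open>z\<close>, carried either by the same frog or by a fresh one.
  In the first case the event becomes smaller for each of at most \<open>2 ^ H\<close> durations. In the second
  case nothing is used about the new frog but that it is at \<open>z\<close> at some time of its own below \<open>2 ^ H\<close>. The home
  of this frog may be any vertex, and the sum over it is bounded by reversibility.\<close>

lemma jump_mass:
  fixes \<iota> :: "vertex \<Rightarrow> nat" and k :: nat and h N :: nat and b :: "nat \<Rightarrow> bool"
  assumes st: "consistent U A u k y" and z: "z \<in> tree_verts d n"
    and bd: "\<And>U \<iota> A u k. consistent U A u k z \<Longrightarrow>
      mass (realized h b N U \<iota> A u k z) \<le> history_prob d n p U \<iota> A * ennreal w" and w: "w \<ge> 0"
  defines "S1 \<equiv> \<lambda>t. realized h b N U \<iota> (A(u := A u \<inter> {X. X (k + t) = z})) u (k + t) z"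
    and "S2 \<equiv> \<lambda>x l i. realized h b N (insert x U) (\<iota>(x := i)) (A(x := {X. X l = z})) x l z"
  defines "T \<equiv> \<lambda>v. (\<Union>t<2 ^ H. S1 t v) \<union> (\<Union>(x, l)\<in>(tree_verts d n - U) \<times> {..<2 ^ H}. \<Union>i. S2 x l i v)"
  shows "family_measurable T" "mass T \<le> history_prob d n p U \<iota> A * ennreal (jump_cost * w)"
proof -
  let ?pr = "history_prob d n p U \<iota> A"
  let ?I = "(tree_verts d n - U) \<times> {..<(2::nat) ^ H}"
  have U: "finite U" "u \<in> U" "[] \<in> U" using st by (auto simp: consistent_def)
  have fin: "finite ?I" using finite_tree_verts by auto
  have m1: "family_measurable (S1 t)" for t unfolding S1_def by (rule realized_measurable[OF consistent_jump(1)[OF st z]])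
  have m2: "family_measurable (S2 x l i)" if "x \<in> tree_verts d n - U" for x l i
    unfolding S2_def by (rule realized_measurable[OF consistent_jump(2)[OF st z]]) (use that in auto)
  have m3: "family_measurable (\<lambda>v. \<Union>i. S2 (fst q) (snd q) i v)" if "q \<in> ?I" for q
    using m2 that by (intro family_measurable_UN) auto
  have m4: "family_measurable (\<lambda>v. \<Union>q\<in>?I. \<Union>i. S2 (fst q) (snd q) i v)"
    using m3 countable_finite[OF fin] by (rule family_measurable_UN)
  have m5: "family_measurable (\<lambda>v. \<Union>t<2 ^ H. S1 t v)" using m1 by (intro family_measurable_UN) auto
  have T: "T = (\<lambda>v. (\<Union>t<2 ^ H. S1 t v) \<union> (\<Union>q\<in>?I. \<Union>i. S2 (fst q) (snd q) i v))"
    unfolding T_def by (simp add: case_prod_beta)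
  show "family_measurable T" unfolding T using m5 m4 by (rule family_measurable_Un)
  have b1: "mass (S1 t) \<le> ?pr * ennreal w" for t
  proof -
    have "mass (S1 t) \<le> history_prob d n p U \<iota> (A(u := A u \<inter> {X. X (k + t) = z})) * ennreal w"
      unfolding S1_def by (rule bd[OF consistent_jump(1)[OF st z]])
    also have "history_prob d n p U \<iota> (A(u := A u \<inter> {X. X (k + t) = z})) \<le> ?pr * 1"
      using U st by (intro history_prob_update) (auto intro!: emeasure_mono simp: consistent_def sets_srw)
    finally show ?thesis by (simp add: mult_right_mono)
  qed
  have b2: "(\<Sum>i. mass (S2 x l i)) \<le> ?pr * ennreal w * ennreal \<mu> * emeasure (srw d n x) {X. X l = z}"
    if x: "x \<in> tree_verts d n - U" for x l
  proof -
    have xn: "x \<in> nonroot_verts d n" using x U by (auto simp: nonroot_verts_def)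
    have "mass (S2 x l i) \<le> ?pr * ennreal w * emeasure (srw d n x) {X. X l = z} * frog_exists_prob p x i" for i
    proof -
      have "mass (S2 x l i) \<le> history_prob d n p (insert x U) (\<iota>(x := i)) (A(x := {X. X l = z})) * ennreal w"
        unfolding S2_def using bd[OF consistent_jump(2)[OF st z]] x by auto
      then show ?thesis using x U by (simp add: history_prob_insert mult_ac)
    qed
    then have "(\<Sum>i. mass (S2 x l i)) \<le> (\<Sum>i. ?pr * ennreal w * emeasure (srw d n x) {X. X l = z} * frog_exists_prob p x i)"
      by (intro suminf_le) auto
    also have "\<dots> = ?pr * ennreal w * emeasure (srw d n x) {X. X l = z} * (\<Sum>i. frog_exists_prob p x i)" by simp
    also have "\<dots> \<le> ?pr * ennreal w * emeasure (srw d n x) {X. X l = z} * ennreal \<mu>"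
      by (intro mult_left_mono suminf_count_le[OF xn]) simp
    finally show ?thesis by (simp add: mult_ac)
  qed
  have "mass T \<le> mass (\<lambda>v. \<Union>t<2 ^ H. S1 t v) + mass (\<lambda>v. \<Union>q\<in>?I. \<Union>i. S2 (fst q) (snd q) i v)"
    unfolding T using m5 m4 by (rule mass_Un)
  also have "\<dots> \<le> (\<Sum>t<(2::nat) ^ H. mass (S1 t)) + (\<Sum>q\<in>?I. mass (\<lambda>v. \<Union>i. S2 (fst q) (snd q) i v))"
    using m1 m3 by (intro add_mono mass_UN_finite fin) auto
  also have "\<dots> \<le> (\<Sum>t<(2::nat) ^ H. ?pr * ennreal w) +
      (\<Sum>q\<in>?I. ?pr * ennreal w * ennreal \<mu> * emeasure (srw d n (fst q)) {X. X (snd q) = z})"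
  proof (intro add_mono sum_mono b1)
    fix q assume q: "q \<in> ?I"
    have "mass (\<lambda>v. \<Union>i. S2 (fst q) (snd q) i v) \<le> (\<Sum>i. mass (S2 (fst q) (snd q) i))"
      using m2 q by (intro mass_UN_nat) auto
    also have "\<dots> \<le> ?pr * ennreal w * ennreal \<mu> * emeasure (srw d n (fst q)) {X. X (snd q) = z}"
      using q by (intro b2) auto
    finally show "mass (\<lambda>v. \<Union>i. S2 (fst q) (snd q) i v) \<le> \<dots>" .
  qed
  also have "\<dots> = of_nat (2 ^ H) * (?pr * ennreal w) + ?pr * ennreal w * ennreal \<mu> *
      (\<Sum>l<(2::nat) ^ H. \<Sum>x\<in>tree_verts d n - U. emeasure (srw d n x) {X. X l = z})"
  proof -
    have "(\<Sum>q\<in>?I. emeasure (srw d n (fst q)) {X. X (snd q) = z}) =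
        (\<Sum>x\<in>tree_verts d n - U. \<Sum>l<(2::nat) ^ H. emeasure (srw d n x) {X. X l = z})"
      by (simp add: sum.cartesian_product case_prod_beta)
    also have "\<dots> = (\<Sum>l<(2::nat) ^ H. \<Sum>x\<in>tree_verts d n - U. emeasure (srw d n x) {X. X l = z})"
      by (rule sum.swap)
    finally show ?thesis by (simp add: sum_distrib_left[symmetric] mult_ac)
  qed
  also have "\<dots> \<le> of_nat (2 ^ H) * (?pr * ennreal w) + ?pr * ennreal w * ennreal \<mu> *
      (\<Sum>l<(2::nat) ^ H. ennreal (real d + 1))"
  proof (intro add_left_mono mult_left_mono sum_mono)
    fix l
    have "(\<Sum>x\<in>tree_verts d n - U. emeasure (srw d n x) {X. X l = z}) \<le>
        (\<Sum>x\<in>tree_verts d n. emeasure (srw d n x) {X. X l = z})"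
      by (intro sum_mono2 finite_tree_verts) auto
    also have "\<dots> \<le> ennreal (real d + 1)" by (rule sum_srw_at_le[OF z d_n_pos])
    finally show "(\<Sum>x\<in>tree_verts d n - U. emeasure (srw d n x) {X. X l = z}) \<le> ennreal (real d + 1)" .
  qed simp
  also have "\<dots> = ?pr * ennreal (jump_cost * w)"
  proof -
    have p: "of_nat (2 ^ H) = ennreal (2 ^ H)" by (metis ennreal_of_nat_eq_real_of_nat of_nat_numeral of_nat_power)
    have "jump_cost * w = 2 ^ H * w + w * \<mu> * (2 ^ H * (real d + 1))"
      by (simp add: jump_cost_def algebra_simps)
    then have "ennreal (jump_cost * w) = ennreal (2 ^ H) * ennreal w + ennreal w * ennreal \<mu> * (ennreal (2 ^ H) * ennreal (real d + 1))"
      using w mu0 by (simp only: ennreal_plus ennreal_mult' ennreal_mult mult_nonneg_nonneg zero_le_power zero_le_numeral)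
    then show ?thesis by (simp add: p distrib_left mult_ac del: of_nat_power)
  qed
  finally show "mass T \<le> ?pr * ennreal (jump_cost * w)" .
qed

text \<open>At the lower end of a zone, the next excursion is either short, when the chain can be seen as starting in the next
  zone with a fresh jump, or long. For \<open>h = 1\<close> the chain is at a leaf and there is no short excursion, as its
  duration would have to be below \<open>1\<close>.\<close>

lemma jump_bound:
  assumes st: "consistent U A u k y" and h: "1 \<le> h" "h \<le> H" and y: "length y = n - (h - 1) * j"
    and IH: "potential_bounds N h"
    and short: "2 \<le> h \<Longrightarrow> mass (realized (h - 1) (b(h - 1 := True)) (Suc N) U \<iota> A u k y) \<le>
      history_prob d n p U \<iota> A * ennreal (pot (h - 1) (b(h - 1 := True)) (length y))"
  shows "mass (realized h b (Suc N) U \<iota> A u k y) \<le> history_prob d n p U \<iota> A * ennreal (pot h b (length y))"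
proof -
  let ?pr = "history_prob d n p U \<iota> A"
  let ?b = "b(h - 1 := True)" and ?b' = "b(h := False)"
  let ?z = "tl y"
  define w where "w = pot h ?b' (length y - 1)"
  have w: "w \<ge> 0" by (simp add: w_def pot_nonneg)
  have yt: "y \<in> tree_verts d n" and U: "finite U" "u \<in> U" "[] \<in> U"
    using st by (auto simp: consistent_def)
  then have z: "?z \<in> tree_verts d n" by (cases y) (auto simp: tree_verts_def)
  (* S0: short excursion; S1, S2: long excursion, carried out by the same or by another frog. *)
  define S0 where "S0 = (if 2 \<le> h then realized (h - 1) ?b (Suc N) U \<iota> A u k y else (\<lambda>v. {}))"
  define S1 where "S1 t = realized h ?b' N U \<iota> (A(u := A u \<inter> {X. X (k + t) = ?z})) u (k + t) ?z" for t
  define S2 where "S2 x l i = realized h ?b' N (insert x U) (\<iota>(x := i)) (A(x := {X. X l = ?z})) x l ?z" for x l i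
  define T where "T v = (\<Union>t<2 ^ H. S1 t v) \<union> (\<Union>(x, l)\<in>(tree_verts d n - U) \<times> {..<2 ^ H}. \<Union>i. S2 x l i v)" for v
  define T' where "T' = (if b h then T else (\<lambda>v. {}))"
  have lev: "length y = n - h * j + j" using level_arith(1)[OF h] y by simp
  have bd: "mass (realized h ?b' N U \<iota> A u k ?z) \<le> history_prob d n p U \<iota> A * ennreal w" if "consistent U A u k ?z" for U \<iota> A u k
  proof -
    have "lowest_level h \<le> length ?z" "length ?z \<le> n - (h - 1) * j" using lev y j2 h by (auto simp: lowest_level_def)
    with that show ?thesis
      using IH[unfolded potential_bounds_def, rule_format, of U A u k ?z ?b' \<iota>] by (simp add: w_def)
  qed
  have mT: "family_measurable T" "mass T \<le> ?pr * ennreal (jump_cost * w)"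
    using jump_mass[OF st z bd w, of \<iota>] unfolding T_def S1_def S2_def by blast+
  have m0: "family_measurable S0" using realized_measurable[OF st] family_measurable_empty by (auto simp: S0_def)
  have mT': "family_measurable T'" using mT(1) by (simp add: T'_def family_measurable_empty)
  have sub: "realized h b (Suc N) U \<iota> A u k y v \<subseteq> S0 v \<union> T' v" for v
  proof
    fix \<omega> assume "\<omega> \<in> realized h b (Suc N) U \<iota> A u k y v"
    then obtain ms where hi: "\<omega> \<in> history U \<iota> A" and ms: "length ms < Suc N" "route d n y ms" "distinct (switches ms)"
        "set (switches ms) \<inter> U = {}" "end_vertex y ms = v" "deadlines h b y ms"
        "follows (fst \<omega>) (snd \<omega>) (u, \<iota> u) k ms"
      unfolding realized_def completable_def by blast
    show "\<omega> \<in> S0 v \<union> T' v"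
    proof (cases "\<exists>t<2 ^ (h - 1). exits (length y) t y ms")
      case True
      have "h \<noteq> 1" using True by (auto simp: exits_def)
      then have h2: "2 \<le> h" using h by simp
      have "deadlines (h - 1) ?b y ms"
        unfolding deadlines_def
      proof
        fix h' assume h': "h' \<in> {h - 1..H}"
        show "\<exists>t < 2 ^ (if ?b h' then h' else h' - 1). exits (n - h' * j) t y ms"
        proof (cases "h' = h - 1")
          case True
          then show ?thesis using \<open>\<exists>t<2 ^ (h - 1). exits (length y) t y ms\<close> y by simp
        next
          case False
          then have "h' \<in> {h..H}" using h' by auto
          then show ?thesis using ms(6) False unfolding deadlines_def by auto
        qed
      qed
      then have "\<omega> \<in> completable (h - 1) ?b (Suc N) U y (u, \<iota> u) k v" using ms by (intro completableI[of ms]) auto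
      then show ?thesis using hi h2 by (simp add: S0_def realized_def)
    next
      case False
      from long_excursion[OF ms(2,6) h y False] obtain s where s: "1 \<le> s" "s \<le> length ms" "s < 2 ^ H" "b h"
        "end_vertex y (take s ms) = ?z" "deadlines h ?b' ?z (drop s ms)" by blast
      define ms1 ms2 where ms1: "ms1 = take s ms" and ms2: "ms2 = drop s ms"
      have len: "length ms1 = s" "length ms2 < N" unfolding ms1 ms2 using s ms(1) by auto
      have e1: "end_vertex y ms1 = ?z" "deadlines h ?b' ?z ms2" unfolding ms1 ms2 by (fact s)+
      have m12: "ms = ms1 @ ms2" unfolding ms1 ms2 by simp
      have e2: "end_vertex ?z ms2 = v" "route d n y ms1" "route d n ?z ms2" "distinct (switches ms2)"
          "set (switches ms1) \<inter> U = {}" "set (switches ms2) \<inter> U = {}"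
          "set (switches ms1) \<inter> set (switches ms2) = {}"
        using ms(2-5) e1(1) unfolding m12 by auto
      obtain g l where gl: "carrier_after (u, \<iota> u) k ms1 = (g, l)" by (cases "carrier_after (u, \<iota> u) k ms1")
      have f12: "follows (fst \<omega>) (snd \<omega>) (u, \<iota> u) k ms1" "follows (fst \<omega>) (snd \<omega>) g l ms2"
        using ms(7) gl unfolding m12 by (auto simp: follows_append)
      have Xk: "snd \<omega> (u, \<iota> u) k = y" using hi st by (auto simp: history_def consistent_def)
      have Xg: "snd \<omega> g l = ?z" using carrier_at_end_vertex[OF f12(1) Xk gl] e1(1) by simp
      consider "g = (u, \<iota> u)" "l = k + s"
        | "l < s" "fst g \<in> set (switches ms1)" "snd g < frogs_at (fst \<omega>) (fst g)"
        using carrier_after_cases[OF f12(1) gl] len by auto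
      then have "\<omega> \<in> T v"
      proof cases
        case 1
        have "\<omega> \<in> history U \<iota> (A(u := A u \<inter> {X. X (k + s) = ?z}))"
          using hi Xg 1 by (auto simp: history_def)
        moreover have "\<omega> \<in> completable h ?b' N U ?z (u, \<iota> u) (k + s) v"
          using len e1(2) e2 f12(2) 1 by (intro completableI[of ms2]) auto
        ultimately have "\<omega> \<in> S1 s v" by (simp add: S1_def realized_def)
        then show ?thesis using s(3) by (auto simp: T_def)
      next
        case 2
        obtain x i where g: "g = (x, i)" by (cases g)
        have x: "x \<in> tree_verts d n - U"
          using switches_route[OF e2(2)] 2(2) e2(5) g by (auto simp: nonroot_verts_def)
        have "\<omega> \<in> history (insert x U) (\<iota>(x := i)) (A(x := {X. X l = ?z}))"
          using hi Xg 2 g x by (auto simp: history_def)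
        moreover have "\<omega> \<in> completable h ?b' N (insert x U) ?z (x, (\<iota>(x := i)) x) l v"
          using len e1(2) e2 f12(2) g 2(2) by (intro completableI[of ms2]) auto
        ultimately have "\<omega> \<in> S2 x l i v" by (simp add: S2_def realized_def)
        moreover have "(x, l) \<in> (tree_verts d n - U) \<times> {..<2 ^ H}" using x 2(1) s(3) by auto
        ultimately show ?thesis unfolding T_def by blast
      qed
      then show ?thesis using s(4) by (simp add: T'_def)
    qed
  qed
  have "mass (realized h b (Suc N) U \<iota> A u k y) \<le> mass (\<lambda>v. S0 v \<union> T' v)"
    using sub m0 mT' by (intro mass_mono family_measurable_Un)
  also have "\<dots> \<le> mass S0 + mass T'" using m0 mT' by (rule mass_Un)
  also have "\<dots> \<le> ?pr * ennreal (pot (h - 1) ?b (length y)) + ?pr * ennreal (if b h then jump_cost * w else 0)"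
  proof (rule add_mono)
    show "mass S0 \<le> ?pr * ennreal (pot (h - 1) ?b (length y))"
      using short by (auto simp: S0_def mass_def)
    show "mass T' \<le> ?pr * ennreal (if b h then jump_cost * w else 0)"
      using mT(2) by (auto simp: T'_def mass_def)
  qed
  also have "\<dots> = ?pr * ennreal (pot (h - 1) ?b (length y) + (if b h then jump_cost * w else 0))"
    using w jump_cost_nonneg by (subst ennreal_plus) (auto simp: pot_nonneg distrib_left)
  also have "\<dots> \<le> ?pr * ennreal (pot h b (length y))"
    using pot_jump[OF h y, of b] unfolding w_def by (intro mult_left_mono ennreal_leI) auto
  finally show ?thesis .
qed

text \<open>In the whole time below \<open>2 ^ H\<close> every excursion below the top zone is short.\<close>

lemma enter_bound:
  assumes N: "Suc N \<le> 2 ^ H" and st: "consistent U A u k y" and y: "length y = top_depth"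
    and inner: "mass (realized H (b(H := True)) (Suc N) U \<iota> A u k y) \<le>
      history_prob d n p U \<iota> A * ennreal (pot H (b(H := True)) (length y))"
  shows "mass (realized (Suc H) b (Suc N) U \<iota> A u k y) \<le> history_prob d n p U \<iota> A * ennreal (pot (Suc H) b (length y))"
proof -
  have "mass (realized (Suc H) b (Suc N) U \<iota> A u k y) \<le> mass (realized H (b(H := True)) (Suc N) U \<iota> A u k y)"
  proof (rule mass_mono[OF _ realized_measurable[OF st]], rule subsetI)
    fix v \<omega> assume v: "v \<in> targets" and "\<omega> \<in> realized (Suc H) b (Suc N) U \<iota> A u k y v"
    then obtain ms where hi: "\<omega> \<in> history U \<iota> A" and ms: "length ms < Suc N" "route d n y ms" "distinct (switches ms)"
        "set (switches ms) \<inter> U = {}" "end_vertex y ms = v"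
        "follows (fst \<omega>) (snd \<omega>) (u, \<iota> u) k ms"
      unfolding realized_def completable_def by blast
    have lv: "length v = top_depth - 1" using v by (simp add: targets_def)
    then have "ms \<noteq> []" using ms(5) y top_depth_ge by auto
    then have "exits (n - H * j) (length ms) y ms"
      using ms(5) lv top_depth_ge unfolding exits_def top_depth_def[symmetric] by (cases ms) auto
    then have "deadlines H (b(H := True)) y ms"
      unfolding deadlines_def using ms(1) N by (auto intro!: exI[of _ "length ms"])
    then have "\<omega> \<in> completable H (b(H := True)) (Suc N) U y (u, \<iota> u) k v" using ms by (intro completableI[of ms]) auto
    then show "\<omega> \<in> realized H (b(H := True)) (Suc N) U \<iota> A u k y v" using hi by (simp add: realized_def)
  qed
  also have "\<dots> \<le> history_prob d n p U \<iota> A * ennreal (pot H (b(H := True)) (length y))" by (rule inner)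
  also have "\<dots> \<le> history_prob d n p U \<iota> A * ennreal (pot (Suc H) b (length y))"
    using pot_enter[OF H_pos, of b] y by (intro mult_left_mono ennreal_leI) auto
  finally show ?thesis .
qed

text \<open>At the lower end of a zone, the claim for \<open>Suc N\<close> is reduced to the same claim at the top of the
  next zone, where first-step analysis applies.\<close>

lemma all_bounded: "N \<le> 2 ^ H \<Longrightarrow> 1 \<le> h \<Longrightarrow> h \<le> Suc H \<Longrightarrow> potential_bounds N h"
proof (induction N arbitrary: h)
  case 0
  have "realized h b 0 U \<iota> A u k y = (\<lambda>v. {})" for b U \<iota> A u k y
    by (rule ext) (simp add: realized_def completable_def)
  then show ?case unfolding potential_bounds_def by (simp add: mass_def)
next
  case (Suc N)
  have IH: "potential_bounds N h" if "1 \<le> h" "h \<le> Suc H" for h using Suc that by simp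
  note int = interior_bound[OF _ _ _ _ IH]
  show ?case unfolding potential_bounds_def
  proof (intro allI impI)
    fix b U \<iota> A u k y
    assume st: "consistent U A u k y" and lev: "lowest_level h \<le> length y" "length y \<le> n - (h - 1) * j"
    show "mass (realized h b (Suc N) U \<iota> A u k y) \<le> history_prob d n p U \<iota> A * ennreal (pot h b (length y))"
    proof (cases "length y < n - (h - 1) * j")
      case True
      then show ?thesis using int[OF st lev(1) Suc.prems(2,3)] by simp
    next
      case False
      then have y: "length y = n - (h - 1) * j" using lev by simp
      show ?thesis
      proof (cases "h = Suc H")
        case True
        have y': "length y = top_depth" using y True by (simp add: top_depth_def)
        have "length y < n - (H - 1) * j" using level_arith(1)[OF H_pos order_refl] y' j2 by (simp add: top_depth_def)
        then have "mass (realized H (b(H := True)) (Suc N) U \<iota> A u k y) \<le>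
            history_prob d n p U \<iota> A * ennreal (pot H (b(H := True)) (length y))"
          using H_pos y' by (intro int[OF st]) (auto simp: lowest_level_def top_depth_def)
        then show ?thesis using enter_bound[OF Suc.prems(1) st y'] True by simp
      next
        case False
        then have h: "1 \<le> h" "h \<le> H" using Suc.prems by auto
        show ?thesis
        proof (rule jump_bound[OF st h y IH])
          assume h2: "2 \<le> h"
          have "length y < n - (h - 1 - 1) * j" using level_arith(1)[of "h - 1"] h2 h y j2 by simp
          then show "mass (realized (h - 1) (b(h - 1 := True)) (Suc N) U \<iota> A u k y) \<le>
            history_prob d n p U \<iota> A * ennreal (pot (h - 1) (b(h - 1 := True)) (length y))"
            using h2 h y by (intro int[OF st]) (auto simp: lowest_level_def)
        qed (use h in auto)
      qed
    qed
  qed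
qed

lemma card_targets: "card targets = d ^ (top_depth - 1)"
proof -
  have "targets = {v. set v \<subseteq> {..<d} \<and> length v = top_depth - 1}"
    by (auto simp: targets_def tree_verts_def top_depth_def)
  then show ?thesis using card_lists_length_eq[of "{..<d}" "top_depth - 1"] by simp
qed

text \<open>The initial history says only that the root frog starts at the root; its probability is bounded by one.\<close>

lemma visited_bound:
  "(\<Sum>v\<in>targets. emeasure M {\<omega> \<in> space M. \<exists>s<2 ^ H. visited (fst \<omega>) (snd \<omega>) s v}) \<le> ennreal top_const"
proof -
  let ?U = "{[]} :: vertex set" and ?\<iota> = "\<lambda>_ :: vertex. 0 :: nat" and ?A = "\<lambda>_ :: vertex. {X. X 0 = ([] :: vertex)}"
  let ?b = "\<lambda>_ :: nat. True"
  have root: "[] \<in> tree_verts d n" by (simp add: tree_verts_def)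
  have st: "consistent ?U ?A [] 0 []"
    using root prefix_event_at[of 0 "[]"] prefix_event_measurable[OF prefix_event_at[of 0 "[]"]] by (simp add: consistent_def)
  have "(\<Sum>v\<in>targets. emeasure M {\<omega> \<in> space M. \<exists>s<2 ^ H. visited (fst \<omega>) (snd \<omega>) s v})
      \<le> mass (realized (Suc H) ?b (2 ^ H) ?U ?\<iota> ?A [] 0 [])"
    unfolding mass_def
  proof (intro sum_mono emeasure_mono_AE)
    fix v
    show "realized (Suc H) ?b (2 ^ H) ?U ?\<iota> ?A [] 0 [] v \<inter> space M \<in> sets M"
      using realized_measurable[OF st] unfolding family_measurable_def by blast
    show "AE \<omega> in M. \<omega> \<in> {\<omega> \<in> space M. \<exists>s<2 ^ H. visited (fst \<omega>) (snd \<omega>) s v} \<longrightarrow>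
        \<omega> \<in> realized (Suc H) ?b (2 ^ H) ?U ?\<iota> ?A [] 0 [] v \<inter> space M"
      using AE_regular[OF d_n_pos]
    proof eventually_elim
      fix \<omega> :: "(vertex \<Rightarrow> nat) \<times> (frog \<Rightarrow> nat \<Rightarrow> vertex)" assume reg: "regular d n (snd \<omega>)"
      show "\<omega> \<in> {\<omega> \<in> space M. \<exists>s<2 ^ H. visited (fst \<omega>) (snd \<omega>) s v} \<longrightarrow>
        \<omega> \<in> realized (Suc H) ?b (2 ^ H) ?U ?\<iota> ?A [] 0 [] v \<inter> space M"
      proof
        assume "\<omega> \<in> {\<omega> \<in> space M. \<exists>s<2 ^ H. visited (fst \<omega>) (snd \<omega>) s v}"
        then obtain t s where sp: "\<omega> \<in> space M" and t: "t < 2 ^ H" "first_visit (fst \<omega>) (snd \<omega>) t v = Some s" by blast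
        have "s < 2 ^ H" using first_visit_cases[OF t(2)] t(1) by simp
        obtain ms where ms: "length ms = s" "route d n [] ms" "distinct (switches ms)"
            "follows (fst \<omega>) (snd \<omega>) ([], 0) 0 ms" "end_vertex [] ms = v"
          using first_visit_route[OF reg t(2)] by blast
        have "\<omega> \<in> history ?U ?\<iota> ?A"
          using reg root by (auto simp: history_def frogs_at_def regular_def walks_def)
        moreover have "\<omega> \<in> completable (Suc H) ?b (2 ^ H) ?U [] ([], ?\<iota> []) 0 v"
          using ms \<open>s < 2 ^ H\<close> switches_route[OF ms(2)]
          by (intro completableI[of ms]) (auto simp: deadlines_def nonroot_verts_def)
        ultimately show "\<omega> \<in> realized (Suc H) ?b (2 ^ H) ?U ?\<iota> ?A [] 0 [] v \<inter> space M"
          using sp by (simp add: realized_def)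
      qed
    qed
  qed
  also have "\<dots> \<le> history_prob d n p ?U ?\<iota> ?A * ennreal (pot (Suc H) ?b (length ([] :: vertex)))"
    using all_bounded[of "2 ^ H" "Suc H", unfolded potential_bounds_def, rule_format, of ?U ?A "[]" 0 "[]" ?b ?\<iota>] st
    by (simp add: lowest_level_def)
  also have "\<dots> \<le> 1 * ennreal top_const"
  proof (rule mult_mono)
    interpret prob_space "srw d n []" by (rule prob_space_srw)
    show "history_prob d n p ?U ?\<iota> ?A \<le> 1"
      using emeasure_le_1 by (simp add: history_prob_def frog_exists_prob_def)
  qed (simp_all add: pot_def)
  finally show ?thesis by simp
qed

text \<open>If the tree is covered, then all \<open>d ^ (top_depth - 1)\<close> vertices of the level are visited, so that Markov's
  inequality applies to their number.\<close>

lemma cover_time_bound: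
  "measure M {\<omega> \<in> space M. cover_time d n \<omega> < enat (2 ^ H)} \<le> 2 * r ^ (top_depth - 1) / (1 - r)"
proof -
  interpret prob_space M by (rule prob_space_frog_model)
  let ?C = "{\<omega> \<in> space M. cover_time d n \<omega> < enat (2 ^ H)}"
  have "?C \<subseteq> {\<omega> \<in> space M. \<exists>s<2 ^ H. visited (fst \<omega>) (snd \<omega>) s v}" if "v \<in> targets" for v
  proof
    fix \<omega> assume w: "\<omega> \<in> ?C"
    then obtain s where "s < 2 ^ H" "\<forall>v\<in>tree_verts d n. first_visit (fst \<omega>) (snd \<omega>) s v \<noteq> None"
      by (auto simp: cover_time_def case_prod_beta INF_less_iff)
    then show "\<omega> \<in> {\<omega> \<in> space M. \<exists>s<2 ^ H. visited (fst \<omega>) (snd \<omega>) s v}"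
      using w that by (auto simp: targets_def)
  qed
  moreover have "{\<omega> \<in> space M. \<exists>s<2 ^ H. visited (fst \<omega>) (snd \<omega>) s v} \<in> sets M" for v
  proof -
    note measurable_first_visit[measurable]
    show ?thesis by measurable
  qed
  ultimately have "(\<Sum>v\<in>targets. emeasure M ?C) \<le>
      (\<Sum>v\<in>targets. emeasure M {\<omega> \<in> space M. \<exists>s<2 ^ H. visited (fst \<omega>) (snd \<omega>) s v})"
    by (intro sum_mono emeasure_mono)
  also have "\<dots> \<le> ennreal top_const" by (rule visited_bound)
  finally have "ennreal (real d ^ (top_depth - 1) * measure M ?C) \<le> ennreal top_const"
    by (simp add: card_targets emeasure_eq_measure ennreal_of_nat_eq_real_of_nat ennreal_mult' del: of_nat_power)
      (simp add: ennreal_power)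
  then have "real d ^ (top_depth - 1) * measure M ?C \<le> top_const"
    using top_const_pos by simp
  then have "measure M ?C \<le> top_const / real d ^ (top_depth - 1)"
    using d_pos by (simp add: pos_le_divide_eq mult.commute)
  also have "\<dots> = 2 * (1 / (\<beta> * real d)) ^ (top_depth - 1) / (1 - r)"
    unfolding top_const_def using d_pos beta_pos r_less by (simp add: power_mult_distrib power_divide field_simps)
  also have "\<dots> \<le> 2 * r ^ (top_depth - 1) / (1 - r)"
  proof -
    have "\<alpha> * real d \<ge> 1" unfolding \<alpha>_def using d2 by (simp add: pos_le_divide_eq)
    then have "1 / (\<beta> * real d) \<le> r"
      using beta_pos d_pos by (simp add: pos_divide_le_eq alpha_eq mult.assoc)
    then show ?thesis using r_less beta_pos d_pos
      by (intro divide_right_mono mult_left_mono power_mono) auto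
  qed
  finally show ?thesis .
qed

end


section \<open>Choice of the scales\<close>

lemma spread_le:
  fixes d \<mu> :: real
  assumes "d \<ge> 2" "\<mu> \<le> d / 100"
  shows "4 * d * (1 + \<mu>) / (d + 1)\<^sup>2 \<le> 91 / 100"
proof -
  have "4 * d * (1 + \<mu>) \<le> 4 * d * (1 + d / 100)" using assms by (intro mult_left_mono) auto
  also have "\<dots> \<le> 91 / 100 * (d + 1)\<^sup>2"
  proof -
    have "0 \<le> (d - 2) * (87 * d - 44)" using assms by (intro mult_nonneg_nonneg) auto
    then show ?thesis by (simp add: power2_eq_square algebra_simps)
  qed
  finally show ?thesis using assms by (simp add: divide_le_eq)
qed

text \<open>For small \<open>\<epsilon> ln d\<close> the bound \<open>\<mu> \<le> d / 100\<close> gives more than the claim, and for large \<open>\<epsilon> ln d\<close>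
  the bound \<open>\<mu> \<le> d powr (1 - \<epsilon>)\<close> does, with room for all constants.\<close>

lemma spread_le_exp:
  fixes d \<mu> \<epsilon> :: real
  assumes "d \<ge> 2" "0 \<le> \<mu>" "\<mu> \<le> d / 100" "\<mu> \<le> d powr (1 - \<epsilon>)" "\<epsilon> < 1"
  shows "4 * d * (1 + \<mu>) / (d + 1)\<^sup>2 \<le> exp (- (\<epsilon> * ln d / 100))"
proof (cases "\<epsilon> * ln d \<le> 5")
  case True
  have "4 * d * (1 + \<mu>) / (d + 1)\<^sup>2 \<le> 91 / 100" by (rule spread_le[OF assms(1,3)])
  also have "\<dots> \<le> 1 + (- (\<epsilon> * ln d / 100))" using True by simp
  also have "\<dots> \<le> exp (- (\<epsilon> * ln d / 100))" by (rule exp_ge_add_one_self)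
  finally show ?thesis .
next
  case False
  define E where "E = \<epsilon> * ln d"
  have E: "E > 5" using False by (simp add: E_def)
  have pw: "d powr (1 - \<epsilon>) = d * exp (- E)"
    using assms(1) by (simp add: E_def powr_def left_diff_distrib exp_diff exp_minus field_simps)
  have "1 \<le> d powr (1 - \<epsilon>)" using assms by (intro ge_one_powr_ge_zero) auto
  then have "1 + \<mu> \<le> 2 * (d * exp (- E))" using assms(4) pw by linarith
  then have "4 * d * (1 + \<mu>) \<le> 4 * d * (2 * (d * exp (- E)))" using assms(1) by (intro mult_left_mono) auto
  also have "\<dots> = 8 * exp (- E) * d\<^sup>2" by (simp add: power2_eq_square)
  also have "\<dots> \<le> 8 * exp (- E) * (d + 1)\<^sup>2"
    using assms(1) by (intro mult_left_mono power_mono) auto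
  finally have "4 * d * (1 + \<mu>) / (d + 1)\<^sup>2 \<le> 8 * exp (- E)"
    using assms(1) by (simp add: divide_le_eq)
  also have "\<dots> \<le> exp (- (E / 100))"
  proof -
    have "8 \<le> 1 + (99 / 100 * E)\<^sup>2 / 2 + 99 / 100 * E"
    proof -
      have "4 * 4 \<le> (99 / 100 * E) * (99 / 100 * E)" using E by (intro mult_mono) auto
      then show ?thesis using E by (simp add: power2_eq_square)
    qed
    also have "\<dots> \<le> exp (99 / 100 * E)" using exp_lower_Taylor_quadratic[of "99 / 100 * E"] E by simp
    finally have "8 * exp (- E) \<le> exp (99 / 100 * E) * exp (- E)" by simp
    also have "\<dots> = exp (- (E / 100))" by (simp add: mult_exp_exp)
    finally show ?thesis .
  qed
  finally show ?thesis by (simp add: E_def)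
qed

theorem theorem4p1:
  shows "\<exists>c::real. c > 0 \<and>
    (\<forall>(d::nat) (\<epsilon>::real) (\<mu>::real) (n::nat) (p :: vertex \<Rightarrow> nat pmf).
       d \<ge> 2 \<longrightarrow> 0 < \<epsilon> \<longrightarrow> \<epsilon> < 1 \<longrightarrow>
       \<mu> \<le> min (real d powr (1 - \<epsilon>)) (real d / 100) \<longrightarrow>
       (\<forall>v\<in>nonroot_verts d n.
          integrable (measure_pmf (p v)) real \<and> measure_pmf.expectation (p v) real \<le> \<mu>) \<longrightarrow>
       real n \<ge> ln (real d) / (c\<^sup>2 * \<epsilon>) \<longrightarrow>
       measure (frog_model d n p)
         {\<omega> \<in> space (frog_model d n p).
            ereal_of_enat (cover_time d n \<omega>) < ereal (exp (c * sqrt (\<epsilon> * real n * ln (real d))))}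
       \<le> exp (- c * sqrt (\<epsilon> * real n * ln (real d))))"
proof (intro exI[of _ "1 / 200 :: real"] conjI allI impI)
  fix d n :: nat and \<epsilon> \<mu> :: real and p :: "vertex \<Rightarrow> nat pmf"
  assume d: "2 \<le> d" and eps: "0 < \<epsilon>" "\<epsilon> < 1" and mu: "\<mu> \<le> min (real d powr (1 - \<epsilon>)) (real d / 100)"
    and mean: "\<forall>v\<in>nonroot_verts d n. integrable (measure_pmf (p v)) real \<and> measure_pmf.expectation (p v) real \<le> \<mu>"
    and n: "ln (real d) / ((1 / 200)\<^sup>2 * \<epsilon>) \<le> real n"
  define x where "x = 1 / 200 * sqrt (\<epsilon> * real n * ln (real d))"
  define E where "E = \<epsilon> * ln (real d)"
  have ln2: "2 / 3 \<le> ln (2 :: real)" by (rule ln2_ge_two_thirds)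
  have lnd: "ln 2 \<le> ln (real d)" using d by simp
  have E: "E > 0" using eps ln2 lnd by (simp add: E_def)
  have n': "40000 * ln (real d) \<le> \<epsilon> * real n" using n eps by (simp add: field_simps power2_eq_square)
  have x0: "x \<ge> 0" using eps ln2 lnd by (simp add: x_def)
  have x2: "40000 * x\<^sup>2 = real n * E"
    using eps ln2 lnd by (simp add: x_def E_def power_mult_distrib power2_eq_square mult_ac)
  have x_ln: "ln (real d) \<le> x"
  proof (rule power2_le_imp_le[OF _ x0])
    have "40000 * ln (real d) * ln (real d) \<le> \<epsilon> * real n * ln (real d)"
      using n' ln2 lnd by (intro mult_right_mono) auto
    then show "(ln (real d))\<^sup>2 \<le> x\<^sup>2" using x2 by (simp add: E_def power2_eq_square mult_ac)
  qed
  have x23: "2 / 3 \<le> x" using x_ln lnd ln2 by simp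
  have xE: "E \<le> x"
  proof -
    have "E \<le> 1 * ln (real d)" unfolding E_def using eps ln2 lnd by (intro mult_right_mono) auto
    then show ?thesis using x_ln by simp
  qed
  have d_exp: "real d \<le> exp x" using x_ln d by (metis exp_ln exp_le_cancel_iff of_nat_0_less_iff order_less_le_trans pos2)
  have exp8: "256 \<le> exp (8 * x)"
  proof -
    have "(2::real) ^ 8 \<le> exp x ^ 8" using d_exp d by (intro power_mono) auto
    then show ?thesis by (simp add: exp_of_nat_mult[symmetric])
  qed
  have n_ge: "real n \<ge> 20000"
  proof -
    have "\<epsilon> * real n \<le> 1 * real n" using eps by (intro mult_right_mono) auto
    then show ?thesis using n' ln2 lnd by linarith
  qed
  have mu0: "0 \<le> \<mu>"
  proof -
    have "[0] \<in> nonroot_verts d n" using d n_ge by (auto simp: nonroot_verts_def tree_verts_def)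
    then have "measure_pmf.expectation (p [0]) real \<le> \<mu>" using mean by blast
    with Bochner_Integration.integral_nonneg show ?thesis by (rule order.trans) simp
  qed
  (* The time exp x is rounded up to a power of two. The factor 1200 in j makes r ^ j at most
     exp (- 12 x), which beats the jump cost of order exp (3 x) and all constants. *)
  define H where "H = nat \<lceil>x / ln 2\<rceil>"
  define j where "j = nat \<lceil>1200 * (x / E)\<rceil>"
  define r where "r = 4 * real d * (1 + \<mu>) / (real d + 1)\<^sup>2"
  have r0: "0 \<le> r" unfolding r_def using mu0 by simp
  have r91: "r \<le> 91 / 100" unfolding r_def using d mu by (intro spread_le) auto
  then have r1: "r < 1" by simp
  have r_exp: "r \<le> exp (- (E / 100))"
    unfolding r_def E_def using d mu mu0 eps by (intro spread_le_exp) auto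
  have Hreal: "x / ln 2 \<le> real H" "real H \<le> x / ln 2 + 1"
    unfolding H_def using x0 ln2 by (auto simp: of_nat_nat)
  have twoH: "2 ^ H = exp (real H * ln 2)" by (simp add: exp_of_nat_mult)
  have H_low: "exp x \<le> 2 ^ H" unfolding twoH using Hreal(1) ln2 by (simp add: divide_le_eq)
  have H_up: "2 ^ H \<le> 2 * exp x"
  proof -
    have "real H * ln 2 \<le> (x / ln 2 + 1) * ln 2" using Hreal(2) ln2 by (intro mult_right_mono) auto
    also have "\<dots> = x + ln 2" using ln2 by (simp add: field_simps)
    finally have "2 ^ H \<le> exp (x + ln 2)" unfolding twoH by simp
    then show ?thesis by (simp add: exp_add)
  qed
  have H3: "real H \<le> 3 * x"
  proof -
    have "x / ln 2 \<le> x / (2 / 3)" using ln2 x0 by (intro divide_left_mono) auto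
    also have "\<dots> = 3 / 2 * x" by simp
    finally show ?thesis using Hreal(2) x23 by argo
  qed
  have H1: "1 \<le> H"
  proof -
    have "0 < x / ln 2" using x23 ln2 by (intro divide_pos_pos) auto
    then show ?thesis using Hreal(1) by linarith
  qed
  have xE1: "1 \<le> x / E" using xE E by simp
  have jreal: "1200 * (x / E) \<le> real j" "real j \<le> 1201 * (x / E)"
  proof -
    show "1200 * (x / E) \<le> real j" unfolding j_def by (rule real_nat_ceiling_ge)
    have "real j \<le> 1200 * (x / E) + 1" unfolding j_def using xE1 by (simp add: of_nat_nat)
    then show "real j \<le> 1201 * (x / E)" using xE1 by linarith
  qed
  have j2: "2 \<le> j" using jreal(1) xE1 by linarith
  have Hj: "real (H * j) \<le> real n / 2"
  proof -
    have "real (H * j) \<le> (3 * x) * (1201 * (x / E))"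
      unfolding of_nat_mult using H3 jreal(2) x0 by (intro mult_mono) auto
    also have "\<dots> = 3603 * x\<^sup>2 / E" by (simp add: power2_eq_square)
    also have "\<dots> \<le> 20000 * x\<^sup>2 / E" using E by (intro divide_right_mono) auto
    also have "\<dots> = real n / 2" using x2 E by (simp add: field_simps)
    finally show ?thesis .
  qed
  then have Hjn: "H * j + 2 \<le> n" using n_ge by linarith
  have r_pow: "r ^ m \<le> exp (- (real m * E / 100))" for m
  proof -
    have "r ^ m \<le> exp (- (E / 100)) ^ m" by (rule power_mono[OF r_exp r0])
    also have "\<dots> = exp (- (real m * E / 100))" by (simp add: exp_of_nat_mult[symmetric])
    finally show ?thesis .
  qed
  have r_j: "r ^ j \<le> exp (- (12 * x))"
  proof -
    have "1200 * x \<le> real j * E" using jreal(1) E by (simp add: field_simps)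
    then show ?thesis by (intro order.trans[OF r_pow]) simp
  qed
  have small: "2 ^ H * (1 + \<mu> * (real d + 1)) * r ^ j \<le> 2 / (real d + 1) * (1 - r)\<^sup>2"
  proof -
    have "\<mu> * (real d + 1) \<le> real d / 100 * (2 * real d)" using mu d mu0 by (intro mult_mono) auto
    moreover have "2 * 2 \<le> real d * real d" using d by (intro mult_mono) auto
    ultimately have "1 + \<mu> * (real d + 1) \<le> real d * real d" by simp
    also have "\<dots> \<le> exp x * exp x" using d_exp by (intro mult_mono) auto
    finally have a: "1 + \<mu> * (real d + 1) \<le> exp x * exp x" .
    have "2 ^ H * (1 + \<mu> * (real d + 1)) * r ^ j \<le> (2 * exp x) * (exp x * exp x) * exp (- (12 * x))"
      using H_up a r_j r0 mu0 by (intro mult_mono) auto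
    also have "\<dots> = 2 * exp (- (9 * x))" by (simp add: mult_exp_exp)
    also have "\<dots> \<le> exp (- x) * (9 / 100)\<^sup>2"
    proof -
      have "256 * exp (- (9 * x)) \<le> exp (8 * x) * exp (- (9 * x))" using exp8 by simp
      also have "\<dots> = exp (- x)" by (simp add: mult_exp_exp)
      finally have "256 * exp (- (9 * x)) \<le> exp (- x)" .
      moreover have "0 < exp (- (9 * x))" by simp
      ultimately have "20000 * exp (- (9 * x)) \<le> exp (- x) * 81" by linarith
      then show ?thesis by (simp add: power2_eq_square)
    qed
    also have "\<dots> \<le> 2 / (real d + 1) * (1 - r)\<^sup>2"
    proof (rule mult_mono)
      have "exp (- x) \<le> 1 / real d" using d_exp d by (simp add: exp_minus inverse_eq_divide frac_le)
      also have "\<dots> \<le> 2 / (real d + 1)" using d by (simp add: field_simps)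
      finally show "exp (- x) \<le> 2 / (real d + 1)" .
      show "(9 / 100)\<^sup>2 \<le> (1 - r)\<^sup>2" using r91 by (intro power_mono) auto
    qed auto
    finally show ?thesis .
  qed
  interpret F: frog_scales d n j H \<mu> p
    by unfold_locales (use d mu0 j2 Hjn H1 mean r1 small in \<open>auto simp: r_def\<close>)
  let ?M = "frog_model d n p"
  interpret prob_space ?M by (rule prob_space_frog_model)
  have req: "F.r = r" by (simp add: F.r_def r_def)
  have "{\<omega> \<in> space ?M. ereal_of_enat (cover_time d n \<omega>) < ereal (exp x)} \<subseteq>
      {\<omega> \<in> space ?M. cover_time d n \<omega> < enat (2 ^ H)}"
  proof clarsimp
    fix \<eta> X assume "ereal_of_enat (cover_time d n (\<eta>, X)) < ereal (exp x)"
    then obtain t where t: "cover_time d n (\<eta>, X) = enat t" "real t < exp x"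
      by (cases "cover_time d n (\<eta>, X)") auto
    then have "real t < 2 ^ H" using H_low by linarith
    then have "t < 2 ^ H" using of_nat_less_imp_less[of t "2 ^ H", where 'a=real] by simp
    then show "cover_time d n (\<eta>, X) < enat (2 ^ H)" using t by simp
  qed
  then have "measure ?M {\<omega> \<in> space ?M. ereal_of_enat (cover_time d n \<omega>) < ereal (exp x)} \<le>
      measure ?M {\<omega> \<in> space ?M. cover_time d n \<omega> < enat (2 ^ H)}"
    by (rule finite_measure_mono) measurable
  also have "\<dots> \<le> 2 * r ^ (F.top_depth - 1) / (1 - r)"
    using F.cover_time_bound unfolding req .
  also have "\<dots> \<le> 2 * exp (- (50 * x)) / (9 / 100)"
  proof (intro frac_le mult_left_mono)
    have "real n / 4 \<le> real (F.top_depth - 1)" unfolding F.top_depth_def using Hj n_ge Hjn by linarith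
    then have "real n / 4 * E \<le> real (F.top_depth - 1) * E" using E by (intro mult_right_mono) auto
    then have "10000 * x\<^sup>2 \<le> real (F.top_depth - 1) * E" using x2 by simp
    moreover have "1 * x \<le> 2 * x * x" using x23 by (intro mult_right_mono) auto
    ultimately have "50 * x \<le> real (F.top_depth - 1) * E / 100" using x0 by (simp add: power2_eq_square)
    then show "r ^ (F.top_depth - 1) \<le> exp (- (50 * x))" by (intro order.trans[OF r_pow]) simp
  qed (use r91 r0 in auto)
  also have "\<dots> \<le> exp (8 * x) * exp (- (50 * x))"
    using exp8 by simp
  also have "\<dots> \<le> exp (- x)" using x0 by (simp add: mult_exp_exp)
  finally show "measure ?M {\<omega> \<in> space ?M.
      ereal_of_enat (cover_time d n \<omega>) < ereal (exp (1 / 200 * sqrt (\<epsilon> * real n * ln (real d))))}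
     \<le> exp (- (1 / 200) * sqrt (\<epsilon> * real n * ln (real d)))"
    by (simp add: x_def)
qed simp

end
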